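(* Let $f:\mathcal{M}\to\mathbb{R}$ be $\mathcal{C}^1$-smooth and let $L>0$. Suppose: (1) (descent condition) $f(\mathcal{R}_x(\eta))\le f(x)+\langle \mathrm{grad} f(x),\eta\rangle_x+\frac{L}{2}\|\eta\|^2$ for all $x\in\mathcal{M}$, $\eta\in T_x\mathcal{M}$; (2) (Lipschitz gradient, written $f\in\mathcal{C}^{1,L}$) $\|\mathcal{T}_y^x\,\mathrm{grad} f(y)-\mathrm{grad} f(x)\|\le L\|\eta\|$, or $\|\mathrm{grad} f(y)-\mathcal{T}_{\eta}^{-\sharp}\,\mathrm{grad} f(x)\|\le L\|\eta\|$, for all $x\in\mathcal{M}$, $\eta\in T_x\mathcal{M}$, where $y=\mathcal{R}_x(\eta)$. Let $\nu\in[0,1)$ and let $\{t_k\}_{k\ge1}\subset[0,\infty)$ satisfy $\sum_{k=1}^\infty t_k=\infty$ and $t_k\in\big[0,\frac{2-2\nu-\delta_0}{L(1+\nu)^2}\big]$ for all sufficiently large $k$ and for some $\delta_0>0$. Let $\{x_k\}_{k\ge1}\subset\mathcal{M}$ be a sequence generated by $$x_{k+1}=\mathcal{R}_{x_k}(-t_kg_k),\quad g_k\in T_{x_k}\mathcal{M},\quad \|g_k-\mathrm{grad} f(x_k)\|\le\nu\|\mathrm{grad} f(x_k)\|,\qquad k=1,2,\ldots,$$ with $\inf_k f(x_k)>-\infty$, and let $\mathcal{S}$ be the set of all accumulation points of $\{x_k\}$. Assume that the stepsizes are bounded away from $0$ (there is $\bar t>0$ with $t_k>\bar t$ for all large $k$).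 (i) If $f$ satisfies the Riemannian KL property at some accumulation point $\bar x\in\mathcal{S}$, then $x_k\to\bar x$. (ii) Assume that the Riemannian KL property in (i) holds with the desingularizing function $\varphi(t)=\frac{C}{\theta}t^\theta$, where $C>0$ and $\theta\in(0,1]$. Then either $\{x_k\}$ stops finitely at a stationary point, or the following convergence rates are achieved: - If $\theta=1$, then there exists $k_1$ such that $x_k=\bar x$ for all $k>k_1$. - If $\theta\in[\frac12,1)$, then there exist $C_r>0$ and $Q\in[0,1)$ such that $\|x_k-\bar x\|<C_rQ^k$ for all $k$. - If $\theta\in(0,\frac12)$, then there exists $\widetilde C_r>0$ such that $\|x_k-\bar x\|<\widetilde C_r\,k^{-\frac{1-\theta}{2\theta-1}}$ for all $k$.
   Context: $\mathcal{M}\subset\mathbb{R}^n$ is a Riemannian submanifold embedded in $\mathbb{R}^n$, with inner product $\langle\cdot,\cdot\rangle_x$ on $T_x\mathcal{M}$ varying smoothly in $x$ and induced norm $\|\cdot\|$ on tangent vectors; for points of $\mathcal{M}$, $\|x-y\|$ is the Euclidean norm in $\mathbb{R}^n$. The Riemannian gradient $\mathrm{grad} f(x)\in T_x\mathcal{M}$ is the unique tangent vector with $\langle\mathrm{grad} f(x),\xi\rangle_x=Df(x)[\xi]$ for all $\xi\in T_x\mathcal{M}$; $\bar x$ is stationary for $f$ if $\mathrm{grad} f(\bar x)=0$. $\mathcal{R}:T\mathcal{M}\to\mathcal{M}$ is a retraction: a smooth map whose restriction $\mathcal{R}_x$ to $T_x\mathcal{M}$ satisfies $\mathcal{R}_x(0_x)=x$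 and $D\mathcal{R}_x(0_x)=\mathrm{id}_{T_x\mathcal{M}}$. Standing assumption on the retraction: there is a constant $\kappa>0$ with $\|\mathcal{R}_x(\eta)-x\|\le\kappa\|\eta\|$ for all $x\in\mathcal{M}$, $\eta\in T_x\mathcal{M}$. $\mathcal{T}$ is a vector transport: a smooth map $(\eta_x,\xi_x)\mapsto\mathcal{T}_{\eta_x}(\xi_x)\in T_{\mathcal{R}_x(\eta_x)}\mathcal{M}$, linear in $\xi_x$, with $\mathcal{T}_{0_x}\xi_x=\xi_x$; it is isometric: $\langle\mathcal{T}_{\eta_x}\xi_x,\mathcal{T}_{\eta_x}\zeta_x\rangle_{\mathcal{R}_x(\eta_x)}=\langle\xi_x,\zeta_x\rangle_x$. For $y=\mathcal{R}_x(\eta)$, $\mathcal{T}_y^x:T_y\mathcal{M}\to T_x\mathcal{M}$ denotes $\mathcal{T}_\eta^{-1}$; $\mathcal{T}_\eta^{\sharp}:T_y\mathcal{M}\to T_x\mathcal{M}$ is the adjoint, defined by $\langle\xi_y,\mathcal{T}_\eta\zeta_x\rangle_y=\langle\mathcal{T}_\eta^{\sharp}\xi_y,\zeta_x\rangle_x$, and $\mathcal{T}_\eta^{-\sharp}$ is its inverse. Accumulation points are taken in $\mathcal{M}$. Riemannian KL (Kurdyka-Łojasiewicz) property of $f$ at $\bar x$: there exist $\delta\in(0,\infty]$, a neighborhood $U\subset\mathcal{M}$ of $\bar x$, and a concave continuous function $\varphi:[0,\delta)\to[0,\infty)$ (the desingularizing function) such that $\varphi(0)=0$, $\varphi$ is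 $\mathcal{C}^1$ on $(0,\delta)$, $\varphi'>0$ on $(0,\delta)$, and $\varphi'(f(x)-f(\bar x))\|\mathrm{grad} f(x)\|\ge1$ for all $x\in U$ with $f(\bar x)<f(x)<f(\bar x)+\delta$. *)

theory Defs
  imports "HOL-Analysis.Analysis"
begin

text \<open>
  \<open>Ck_on k S f\<close> is meant for open \<open>S\<close>: all iterated directional derivatives of \<open>f\<close> up to order \<open>k\<close>
  exist and are continuous on \<open>S\<close>.
\<close>

fun Ck_on :: "nat \<Rightarrow> 'a::euclidean_space set \<Rightarrow> ('a \<Rightarrow> 'b::euclidean_space) \<Rightarrow> bool" where
  "Ck_on 0 S f \<longleftrightarrow> continuous_on S f"
| "Ck_on (Suc k) S f \<longleftrightarrow>
     (\<forall>x\<in>S. f differentiable (at x)) \<and>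
     (\<forall>v. Ck_on k S (\<lambda>x. frechet_derivative f (at x) v))"

definition smooth_on :: "'a::euclidean_space set \<Rightarrow> ('a \<Rightarrow> 'b::euclidean_space) \<Rightarrow> bool" where
  "smooth_on S f \<longleftrightarrow> (\<forall>k. Ck_on k S f)"

text \<open>
  Maps on a subset of a Euclidean space that need not be open. If \<open>S\<close> is an embedded submanifold,
  having local extensions of class \<open>C\<^sup>k\<close> (smooth) to open sets is the same as being of class
  \<open>C\<^sup>k\<close> (smooth) as a map on the manifold.
\<close>

definition Ck_extendable_on :: "nat \<Rightarrow> 'a::euclidean_space set \<Rightarrow> ('a \<Rightarrow> 'b::euclidean_space) \<Rightarrow> bool" where
  "Ck_extendable_on k S f \<longleftrightarrow>
     (\<forall>p\<in>S. \<exists>U F. open U \<and> p \<in> U \<and> Ck_on k U F \<and> (\<forall>q\<in>S \<inter> U. F q = f q))"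

definition smooth_extendable_on :: "'a::euclidean_space set \<Rightarrow> ('a \<Rightarrow> 'b::euclidean_space) \<Rightarrow> bool" where
  "smooth_extendable_on S f \<longleftrightarrow>
     (\<forall>p\<in>S. \<exists>U F. open U \<and> p \<in> U \<and> smooth_on U F \<and> (\<forall>q\<in>S \<inter> U. F q = f q))"

definition embedded_submanifold :: "'a::euclidean_space set \<Rightarrow> nat \<Rightarrow> bool" where
  "embedded_submanifold M d \<longleftrightarrow>
     (\<forall>p\<in>M. \<exists>U V \<phi> \<psi> (W :: 'a set).
        open U \<and> p \<in> U \<and> open V \<and>
        homeomorphism U V \<phi> \<psi> \<and> smooth_on U \<phi> \<and> smooth_on V \<psi> \<and>
        subspace W \<and> dim W = d \<and> \<phi> ` (U \<inter> M) = V \<inter> W)"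

definition curve_through :: "'a::euclidean_space set \<Rightarrow> 'a \<Rightarrow> 'a \<Rightarrow> (real \<Rightarrow> 'a) \<Rightarrow> bool" where
  "curve_through M x v c \<longleftrightarrow>
     (\<exists>e>0. smooth_on {-e<..<e} c \<and> c ` {-e<..<e} \<subseteq> M) \<and>
     c 0 = x \<and> (c has_vector_derivative v) (at 0)"

definition tangent_space :: "'a::euclidean_space set \<Rightarrow> 'a \<Rightarrow> 'a set" where
  "tangent_space M x = {v. \<exists>c. curve_through M x v c}"

definition tangent_bundle :: "'a::euclidean_space set \<Rightarrow> ('a \<times> 'a) set" where
  "tangent_bundle M = {(x, v). x \<in> M \<and> v \<in> tangent_space M x}"

text \<open>The Whitney sum of the tangent bundle with itself.\<close>

definition tangent_pairs :: "'a::euclidean_space set \<Rightarrow> ('a \<times> 'a \<times> 'a) set" where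
  "tangent_pairs M = {(x, u, v). x \<in> M \<and> u \<in> tangent_space M x \<and> v \<in> tangent_space M x}"

text \<open>
  The metric is arbitrary, not necessarily the one induced by the ambient space;
  only the values of \<open>g x\<close> on \<open>tangent_space M x\<close> for \<open>x \<in> M\<close> matter.
\<close>

definition riemannian_metric :: "'a::euclidean_space set \<Rightarrow> ('a \<Rightarrow> 'a \<Rightarrow> 'a \<Rightarrow> real) \<Rightarrow> bool" where
  "riemannian_metric M g \<longleftrightarrow>
     (\<forall>x\<in>M. \<forall>u\<in>tangent_space M x. \<forall>v\<in>tangent_space M x. \<forall>w\<in>tangent_space M x. \<forall>a b.
        g x (a *\<^sub>R u + b *\<^sub>R v) w = a * g x u w + b * g x v w) \<and>
     (\<forall>x\<in>M. \<forall>u\<in>tangent_space M x. \<forall>v\<in>tangent_space M x. g x u v = g x v u) \<and>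
     (\<forall>x\<in>M. \<forall>u\<in>tangent_space M x. u \<noteq> 0 \<longrightarrow> g x u u > 0) \<and>
     smooth_extendable_on (tangent_pairs M) (\<lambda>(x, u, v). g x u v)"

definition riem_norm :: "('a \<Rightarrow> 'a \<Rightarrow> 'a \<Rightarrow> real) \<Rightarrow> 'a \<Rightarrow> 'a \<Rightarrow> real" where
  "riem_norm g x v = sqrt (g x v v)"

text \<open>The differential \<open>Df(x)[\<xi>]\<close> of a function on \<open>M\<close>; values of \<open>f\<close> outside \<open>M\<close> are irrelevant.\<close>

definition manifold_differential :: "'a::euclidean_space set \<Rightarrow> ('a \<Rightarrow> real) \<Rightarrow> 'a \<Rightarrow> 'a \<Rightarrow> real" where
  "manifold_differential M f x \<xi> =
     (THE D. \<forall>c. curve_through M x \<xi> c \<longrightarrow> ((\<lambda>t. f (c t)) has_real_derivative D) (at 0))"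

definition riem_grad ::
  "'a::euclidean_space set \<Rightarrow> ('a \<Rightarrow> 'a \<Rightarrow> 'a \<Rightarrow> real) \<Rightarrow> ('a \<Rightarrow> real) \<Rightarrow> 'a \<Rightarrow> 'a" where
  "riem_grad M g f x =
     (THE v. v \<in> tangent_space M x \<and>
        (\<forall>\<xi>\<in>tangent_space M x. g x v \<xi> = manifold_differential M f x \<xi>))"

definition stationary_point ::
  "'a::euclidean_space set \<Rightarrow> ('a \<Rightarrow> 'a \<Rightarrow> 'a \<Rightarrow> real) \<Rightarrow> ('a \<Rightarrow> real) \<Rightarrow> 'a \<Rightarrow> bool" where
  "stationary_point M g f x \<longleftrightarrow> x \<in> M \<and> riem_grad M g f x = 0"

text \<open>
  \<open>R x \<eta>\<close> stands for \<open>\<R>\<^sub>x(\<eta>)\<close>. The derivative at \<open>0\<close> is taken within the linear space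
  \<open>tangent_space M x\<close>, so that it is the differential of the restriction \<open>\<R>\<^sub>x\<close>.
\<close>

definition manifold_retraction :: "'a::euclidean_space set \<Rightarrow> ('a \<Rightarrow> 'a \<Rightarrow> 'a) \<Rightarrow> bool" where
  "manifold_retraction M R \<longleftrightarrow>
     (\<forall>x\<in>M. \<forall>\<eta>\<in>tangent_space M x. R x \<eta> \<in> M) \<and>
     smooth_extendable_on (tangent_bundle M) (\<lambda>(x, \<eta>). R x \<eta>) \<and>
     (\<forall>x\<in>M. R x 0 = x \<and> (R x has_derivative (\<lambda>\<eta>. \<eta>)) (at 0 within tangent_space M x))"

text \<open>\<open>T x \<eta> \<xi>\<close> stands for \<open>\<T>\<^sub>\<eta>(\<xi>)\<close>, where \<open>\<eta>\<close> and \<open>\<xi>\<close> are tangent at \<open>x\<close>.\<close>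

definition vector_transport ::
  "'a::euclidean_space set \<Rightarrow> ('a \<Rightarrow> 'a \<Rightarrow> 'a) \<Rightarrow> ('a \<Rightarrow> 'a \<Rightarrow> 'a \<Rightarrow> 'a) \<Rightarrow> bool" where
  "vector_transport M R T \<longleftrightarrow>
     (\<forall>x\<in>M. \<forall>\<eta>\<in>tangent_space M x. \<forall>\<xi>\<in>tangent_space M x. T x \<eta> \<xi> \<in> tangent_space M (R x \<eta>)) \<and>
     smooth_extendable_on (tangent_pairs M) (\<lambda>(x, \<eta>, \<xi>). T x \<eta> \<xi>) \<and>
     (\<forall>x\<in>M. \<forall>\<eta>\<in>tangent_space M x. \<forall>\<xi>\<in>tangent_space M x. \<forall>\<zeta>\<in>tangent_space M x. \<forall>a b.
        T x \<eta> (a *\<^sub>R \<xi> + b *\<^sub>R \<zeta>) = a *\<^sub>R T x \<eta> \<xi> + b *\<^sub>R T x \<eta> \<zeta>) \<and>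
     (\<forall>x\<in>M. \<forall>\<xi>\<in>tangent_space M x. T x 0 \<xi> = \<xi>)"

definition isometric_transport ::
  "'a::euclidean_space set \<Rightarrow> ('a \<Rightarrow> 'a \<Rightarrow> 'a \<Rightarrow> real) \<Rightarrow> ('a \<Rightarrow> 'a \<Rightarrow> 'a) \<Rightarrow>
     ('a \<Rightarrow> 'a \<Rightarrow> 'a \<Rightarrow> 'a) \<Rightarrow> bool" where
  "isometric_transport M g R T \<longleftrightarrow>
     (\<forall>x\<in>M. \<forall>\<eta>\<in>tangent_space M x. \<forall>\<xi>\<in>tangent_space M x. \<forall>\<zeta>\<in>tangent_space M x.
        g (R x \<eta>) (T x \<eta> \<xi>) (T x \<eta> \<zeta>) = g x \<xi> \<zeta>)"

text \<open>\<open>\<T>\<^sub>\<eta>\<close> inverted as a map from \<open>T\<^sub>xM\<close> onto \<open>T\<^sub>yM\<close>, \<open>y = \<R>\<^sub>x(\<eta>)\<close>.\<close>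

definition transport_inv ::
  "'a::euclidean_space set \<Rightarrow> ('a \<Rightarrow> 'a \<Rightarrow> 'a \<Rightarrow> 'a) \<Rightarrow> 'a \<Rightarrow> 'a \<Rightarrow> 'a \<Rightarrow> 'a" where
  "transport_inv M T x \<eta> = inv_into (tangent_space M x) (T x \<eta>)"

definition transport_adj ::
  "'a::euclidean_space set \<Rightarrow> ('a \<Rightarrow> 'a \<Rightarrow> 'a \<Rightarrow> real) \<Rightarrow> ('a \<Rightarrow> 'a \<Rightarrow> 'a) \<Rightarrow>
     ('a \<Rightarrow> 'a \<Rightarrow> 'a \<Rightarrow> 'a) \<Rightarrow> 'a \<Rightarrow> 'a \<Rightarrow> 'a \<Rightarrow> 'a" where
  "transport_adj M g R T x \<eta> \<xi> =
     (THE v. v \<in> tangent_space M x \<and>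
        (\<forall>\<zeta>\<in>tangent_space M x. g (R x \<eta>) \<xi> (T x \<eta> \<zeta>) = g x v \<zeta>))"

definition transport_adj_inv ::
  "'a::euclidean_space set \<Rightarrow> ('a \<Rightarrow> 'a \<Rightarrow> 'a \<Rightarrow> real) \<Rightarrow> ('a \<Rightarrow> 'a \<Rightarrow> 'a) \<Rightarrow>
     ('a \<Rightarrow> 'a \<Rightarrow> 'a \<Rightarrow> 'a) \<Rightarrow> 'a \<Rightarrow> 'a \<Rightarrow> 'a \<Rightarrow> 'a" where
  "transport_adj_inv M g R T x \<eta> =
     inv_into (tangent_space M (R x \<eta>)) (transport_adj M g R T x \<eta>)"

definition descent_condition ::
  "'a::euclidean_space set \<Rightarrow> ('a \<Rightarrow> 'a \<Rightarrow> 'a \<Rightarrow> real) \<Rightarrow> ('a \<Rightarrow> 'a \<Rightarrow> 'a) \<Rightarrow>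
     ('a \<Rightarrow> real) \<Rightarrow> real \<Rightarrow> bool" where
  "descent_condition M g R f L \<longleftrightarrow>
     (\<forall>x\<in>M. \<forall>\<eta>\<in>tangent_space M x.
        f (R x \<eta>) \<le> f x + g x (riem_grad M g f x) \<eta> + L / 2 * (riem_norm g x \<eta>)\<^sup>2)"

definition lipschitz_gradient ::
  "'a::euclidean_space set \<Rightarrow> ('a \<Rightarrow> 'a \<Rightarrow> 'a \<Rightarrow> real) \<Rightarrow> ('a \<Rightarrow> 'a \<Rightarrow> 'a) \<Rightarrow>
     ('a \<Rightarrow> 'a \<Rightarrow> 'a \<Rightarrow> 'a) \<Rightarrow> ('a \<Rightarrow> real) \<Rightarrow> real \<Rightarrow> bool" where
  "lipschitz_gradient M g R T f L \<longleftrightarrow>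
     (\<forall>x\<in>M. \<forall>\<eta>\<in>tangent_space M x.
        riem_norm g x (transport_inv M T x \<eta> (riem_grad M g f (R x \<eta>)) - riem_grad M g f x)
          \<le> L * riem_norm g x \<eta> \<or>
        riem_norm g (R x \<eta>)
            (riem_grad M g f (R x \<eta>) - transport_adj_inv M g R T x \<eta> (riem_grad M g f x))
          \<le> L * riem_norm g x \<eta>)"

definition accumulation_points_in :: "'a::euclidean_space set \<Rightarrow> (nat \<Rightarrow> 'a) \<Rightarrow> 'a set" where
  "accumulation_points_in M x = {p \<in> M. \<exists>r. strict_mono r \<and> (x \<circ> r) \<longlonglongrightarrow> p}"

text \<open>Only the values of \<open>\<phi>\<close> on \<open>[0,\<delta>)\<close> matter.\<close>

definition desingularizing :: "ereal \<Rightarrow> (real \<Rightarrow> real) \<Rightarrow> bool" where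
  "desingularizing \<delta> \<phi> \<longleftrightarrow>
     (\<forall>t. 0 \<le> t \<and> ereal t < \<delta> \<longrightarrow> 0 \<le> \<phi> t) \<and>
     concave_on {t. 0 \<le> t \<and> ereal t < \<delta>} \<phi> \<and>
     continuous_on {t. 0 \<le> t \<and> ereal t < \<delta>} \<phi> \<and>
     \<phi> 0 = 0 \<and>
     (\<forall>t. 0 < t \<and> ereal t < \<delta> \<longrightarrow> \<phi> differentiable (at t)) \<and>
     continuous_on {t. 0 < t \<and> ereal t < \<delta>} (deriv \<phi>) \<and>
     (\<forall>t. 0 < t \<and> ereal t < \<delta> \<longrightarrow> 0 < deriv \<phi> t)"

definition KL_property_with ::
  "'a::euclidean_space set \<Rightarrow> ('a \<Rightarrow> 'a \<Rightarrow> 'a \<Rightarrow> real) \<Rightarrow> ('a \<Rightarrow> real) \<Rightarrow> 'a \<Rightarrow>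
     (real \<Rightarrow> real) \<Rightarrow> bool" where
  "KL_property_with M g f xbar \<phi> \<longleftrightarrow>
     (\<exists>(\<delta>::ereal) U. 0 < \<delta> \<and>
        U \<subseteq> M \<and> (\<exists>W. openin (top_of_set M) W \<and> xbar \<in> W \<and> W \<subseteq> U) \<and>
        desingularizing \<delta> \<phi> \<and>
        (\<forall>x\<in>U. f xbar < f x \<and> ereal (f x) < ereal (f xbar) + \<delta> \<longrightarrow>
           deriv \<phi> (f x - f xbar) * riem_norm g x (riem_grad M g f x) \<ge> 1))"

definition KL_property ::
  "'a::euclidean_space set \<Rightarrow> ('a \<Rightarrow> 'a \<Rightarrow> 'a \<Rightarrow> real) \<Rightarrow> ('a \<Rightarrow> real) \<Rightarrow> 'a \<Rightarrow> bool" where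
  "KL_property M g f xbar \<longleftrightarrow> (\<exists>\<phi>. KL_property_with M g f xbar \<phi>)"

end

theory Submission
  imports Defs
begin

text \<open>
  The descent condition and \<open>t\<^sub>k > tbar\<close> give a decrease of \<open>f\<close> by at least
  \<open>\<delta>0 / 2 * t\<^sub>k * G\<^sub>k\<^sup>2\<close>, where \<open>G\<^sub>k\<close> is the gradient norm at \<open>x\<^sub>k\<close>, while the retraction bound makes the
  step at most a multiple of \<open>t\<^sub>k * G\<^sub>k\<close>. By concavity of \<open>\<phi>\<close> and the KL inequality at \<open>x\<^sub>k\<close> itself,
  the drop of \<open>\<phi> (f x\<^sub>k - f xbar)\<close> therefore dominates the length of the step, so the iterates
  are trapped near \<open>xbar\<close> and \<open>\<phi> (f x\<^sub>k - f xbar)\<close> bounds the distance to the limit up to a factor.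
  For \<open>\<phi> s = C / \<theta> * s powr \<theta>\<close> the decrease of \<open>f\<close> becomes a recursive inequality for the gap
  \<open>f x\<^sub>k - f xbar\<close>.
\<close>

section \<open>Tangent spaces\<close>

text \<open>Openness of \<open>S\<close> makes agreement on \<open>S\<close> pass to
  \<open>frechet_derivative\<close> at each of its points, so the induction can continue with the
  directional derivatives.\<close>

lemma Ck_on_cong:
  assumes "open S" "\<And>x. x \<in> S \<Longrightarrow> f x = h x" "Ck_on k S f"
  shows "Ck_on k S h"
  using assms(2,3)
proof (induction k arbitrary: f h)
  case 0
  then show ?case by (simp cong: continuous_on_cong_simp)
next
  case (Suc k)
  have diff: "h differentiable (at x)" if x: "x \<in> S" for x
  proof -
    have "f differentiable (at x)" using Suc.prems(2) x by simp
    then obtain D where "(f has_derivative D) (at x)" unfolding differentiable_def by blast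
    then have "(h has_derivative D) (at x)"
      by (rule has_derivative_transform_within_open[OF _ \<open>open S\<close> x Suc.prems(1)])
    then show ?thesis by (auto simp: differentiable_def)
  qed
  have "frechet_derivative f (at x) = frechet_derivative h (at x)" if "x \<in> S" for x
    using Suc.prems that \<open>open S\<close> by (intro frechet_derivative_transform_within_open) auto
  then have "Ck_on k S (\<lambda>x. frechet_derivative h (at x) v)" for v
    using Suc.prems(2) by (rule_tac Suc.IH[of "\<lambda>x. frechet_derivative f (at x) v"]) auto
  with diff show ?case by simp
qed

lemma Ck_on_subset: "Ck_on k S f \<Longrightarrow> S' \<subseteq> S \<Longrightarrow> Ck_on k S' f"
  by (induction k arbitrary: f) (auto intro: continuous_on_subset)

text \<open>By the chain rule, the derivative of the composite in direction \<open>v\<close> is the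
  derivative of \<open>f\<close> in the fixed direction \<open>A v\<close>, again composed with the
  same affine map. The induction hypothesis therefore applies to it directly.\<close>

lemma Ck_on_compose_affine:
  fixes A :: "'a::euclidean_space \<Rightarrow> 'b::euclidean_space"
  assumes "open S" "linear A" "Ck_on k S f"
  shows "Ck_on k ((\<lambda>t. p + A t) -` S) (\<lambda>t. f (p + A t))"
  using assms(3)
proof (induction k arbitrary: f)
  case 0
  have "continuous_on X (\<lambda>t. p + A t)" for X
    using \<open>linear A\<close>
    by (intro continuous_on_add continuous_on_const linear_continuous_on)
      (simp add: linear_conv_bounded_linear)
  then show ?case using 0 continuous_on_compose2[of S f _ "\<lambda>t. p + A t"] by auto
next
  case (Suc k)
  let ?S = "(\<lambda>t. p + A t) -` S"
  have A: "((\<lambda>t. p + A t) has_derivative A) (at t)" for t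
    using has_derivative_add[OF has_derivative_const linear_imp_has_derivative[OF \<open>linear A\<close>]]
    by simp
  have "open ?S"
  proof (rule open_vimage[OF \<open>open S\<close>])
    show "continuous_on UNIV (\<lambda>t. p + A t)"
      by (rule continuous_at_imp_continuous_on, rule ballI, rule has_derivative_continuous[OF A])
  qed
  have D: "((\<lambda>t. f (p + A t)) has_derivative
      (\<lambda>v. frechet_derivative f (at (p + A t)) (A v))) (at t)" if "t \<in> ?S" for t
  proof -
    have "(f has_derivative frechet_derivative f (at (p + A t))) (at (p + A t))"
      using Suc.prems that by (simp flip: frechet_derivative_works)
    from diff_chain_at[OF A this] show ?thesis by (simp add: o_def)
  qed
  have "Ck_on k ?S (\<lambda>t. frechet_derivative (\<lambda>t. f (p + A t)) (at t) v)" for v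
  proof (rule Ck_on_cong[OF \<open>open ?S\<close>])
    show "Ck_on k ?S (\<lambda>t. frechet_derivative f (at (p + A t)) (A v))"
      using Suc.prems by (intro Suc.IH[of "\<lambda>x. frechet_derivative f (at x) (A v)"]) simp
    show "frechet_derivative f (at (p + A t)) (A v) = frechet_derivative (\<lambda>t. f (p + A t)) (at t) v"
      if "t \<in> ?S" for t
      by (subst frechet_derivative_at[OF D[OF that], symmetric]) simp
  qed
  moreover have "\<forall>t\<in>?S. (\<lambda>t. f (p + A t)) differentiable (at t)"
    using D unfolding differentiable_def by blast
  ultimately show ?case by simp
qed

lemma smooth_on_imp_has_derivative:
  assumes "smooth_on S f" "x \<in> S"
  shows "(f has_derivative frechet_derivative f (at x)) (at x)"
proof -
  have "Ck_on (Suc 0) S f" using assms(1) unfolding smooth_on_def by blast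
  then show ?thesis using assms(2) by (simp flip: frechet_derivative_works)
qed

lemma has_vector_derivative_compose:
  assumes "(c has_vector_derivative v) (at s)" "(h has_derivative D) (at (c s))"
  shows "((\<lambda>s. h (c s)) has_vector_derivative D v) (at s)"
  using vector_derivative_diff_chain_within[of c v s UNIV h D] assms
  by (simp add: o_def has_derivative_at_withinI)

lemma has_vector_derivative_quotient_tendsto:
  assumes "(c has_vector_derivative v) (at 0)"
  shows "((\<lambda>s. (1 / s) *\<^sub>R (c s - c 0)) \<longlongrightarrow> v) (at 0)"
proof -
  have "((\<lambda>s. norm (c s - c 0 - s *\<^sub>R v) / norm s) \<longlongrightarrow> 0) (at 0)"
    using assms by (simp add: has_vector_derivative_def has_derivative_at)
  moreover have "norm (c s - c 0 - s *\<^sub>R v) / norm s = norm ((1 / s) *\<^sub>R (c s - c 0) - v)"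
    if "s \<noteq> 0" for s
  proof -
    have "(1 / s) *\<^sub>R (c s - c 0) - v = (1 / s) *\<^sub>R (c s - c 0 - s *\<^sub>R v)"
      using that by (simp add: scaleR_diff_right)
    then show ?thesis by simp
  qed
  then have "\<forall>\<^sub>F s in at 0. norm (c s - c 0 - s *\<^sub>R v) / norm s
      = norm ((1 / s) *\<^sub>R (c s - c 0) - v)"
    by (auto simp: eventually_at_filter)
  ultimately have "((\<lambda>s. norm ((1 / s) *\<^sub>R (c s - c 0) - v)) \<longlongrightarrow> 0) (at 0)"
    using tendsto_cong by fast
  then show ?thesis by (simp add: LIM_zero_iff tendsto_norm_zero_iff)
qed

text \<open>A chart flattens \<open>M\<close> to a subspace \<open>W\<close>. Straight lines in
  \<open>W\<close>, pulled back by the inverse chart, are curves in \<open>M\<close>, which gives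
  one inclusion. Conversely, the chart sends a curve in \<open>M\<close> to a curve that stays in
  \<open>W\<close> near 0 and so has its velocity in \<open>W\<close>.\<close>

lemma tangent_space_chart:
  fixes M :: "'a::euclidean_space set"
  assumes "embedded_submanifold M d" "x \<in> M"
  obtains D and W :: "'a set" where "linear D" "subspace W" "tangent_space M x = D ` W"
proof -
  obtain U V \<phi> \<psi> and W :: "'a set"
    where U: "open U" "x \<in> U" and V: "open V" and hom: "homeomorphism U V \<phi> \<psi>"
      and smooth: "smooth_on U \<phi>" "smooth_on V \<psi>" and W: "subspace W"
      and img: "\<phi> ` (U \<inter> M) = V \<inter> W"
    using assms(1)[unfolded embedded_submanifold_def, rule_format, OF assms(2)] by auto
  let ?p = "\<phi> x" and ?D = "frechet_derivative \<psi> (at (\<phi> x))"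
  have inv: "\<psi> (\<phi> y) = y" if "y \<in> U" for y
    using hom that by (simp add: homeomorphism_apply1)
  have p: "?p \<in> V" "?p \<in> W" using img U \<open>x \<in> M\<close> by blast+
  have D\<psi>: "(\<psi> has_derivative ?D) (at ?p)"
    using smooth(2) p(1) by (rule smooth_on_imp_has_derivative)
  have "?D w \<in> tangent_space M x" if "w \<in> W" for w
  proof -
    let ?c = "\<lambda>s. \<psi> (?p + s *\<^sub>R w)"
    obtain e' where e': "e' > 0" "ball ?p e' \<subseteq> V"
      using openE[OF V p(1)] by blast
    \<comment> \<open>The summand 1 keeps the quotient meaningful when \<open>w = 0\<close>.\<close>
    define e where "e = e' / (norm w + 1)"
    have "e > 0" using e' by (simp add: e_def add_nonneg_pos)
    have inV: "?p + s *\<^sub>R w \<in> V" if "s \<in> {-e<..<e}" for s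
    proof -
      have "norm (s *\<^sub>R w) \<le> \<bar>s\<bar> * (norm w + 1)" by (simp add: mult_left_mono)
      also have "\<dots> < e * (norm w + 1)"
        using that by (intro mult_strict_right_mono) (auto simp: add_nonneg_pos)
      also have "\<dots> = e'" unfolding e_def by (simp add: add_nonneg_eq_0_iff)
      finally have "?p + s *\<^sub>R w \<in> ball ?p e'" by (simp add: dist_norm)
      then show ?thesis using e'(2) by blast
    qed
    have "smooth_on {-e<..<e} ?c"
      unfolding smooth_on_def
    proof
      fix k
      have "Ck_on k ((\<lambda>s. ?p + s *\<^sub>R w) -` V) ?c"
      proof (rule Ck_on_compose_affine[OF V, where A = "\<lambda>s. s *\<^sub>R w"])
        show "linear (\<lambda>s. s *\<^sub>R w)" by (simp add: linear_iff scaleR_add_left)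
        show "Ck_on k V \<psi>" using smooth(2) by (simp add: smooth_on_def)
      qed
      then show "Ck_on k {-e<..<e} ?c" by (rule Ck_on_subset) (use inV in blast)
    qed
    moreover have "?c s \<in> M" if "s \<in> {-e<..<e}" for s
    proof -
      have "?p + s *\<^sub>R w \<in> \<phi> ` (U \<inter> M)"
        unfolding img using inV[OF that] p(2) W \<open>w \<in> W\<close> by (simp add: subspace_add subspace_scale)
      then obtain u where "u \<in> U" "u \<in> M" "?p + s *\<^sub>R w = \<phi> u" by blast
      then show ?thesis using inv by simp
    qed
    moreover have "(?c has_vector_derivative ?D w) (at 0)"
    proof -
      have "((\<lambda>s. ?p + s *\<^sub>R w) has_vector_derivative w) (at 0)"
        unfolding has_vector_derivative_def by (auto intro!: derivative_eq_intros)
      moreover have "(\<psi> has_derivative ?D) (at (?p + 0 *\<^sub>R w))" using D\<psi> by simp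
      ultimately show ?thesis
        by (rule has_vector_derivative_compose)
    qed
    ultimately have "curve_through M x (?D w) ?c"
      unfolding curve_through_def using \<open>e > 0\<close> inv[OF U(2)] by auto
    then show ?thesis by (auto simp: tangent_space_def)
  qed
  moreover have "v \<in> ?D ` W" if v: "v \<in> tangent_space M x" for v
  proof -
    obtain c e where e: "e > 0" "c ` {-e<..<e} \<subseteq> M" and c0: "c 0 = x"
      and c': "(c has_vector_derivative v) (at 0)"
      using v by (auto simp: tangent_space_def curve_through_def)
    let ?w = "frechet_derivative \<phi> (at x) v"
    have "continuous (at 0) c"
      using c' by (rule has_vector_derivative_continuous)
    then have ev_U: "\<forall>\<^sub>F s in at 0. c s \<in> U"
      using U c0 by (simp add: continuous_at topological_tendstoD)
    have "\<forall>\<^sub>F s in at (0::real). s \<in> {-e<..<e}"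
      using e by (intro eventually_at_topological[THEN iffD2] exI[of _ "{-e<..<e}"]) auto
    with ev_U have ev_W: "\<forall>\<^sub>F s in at 0. \<phi> (c s) \<in> W"
    proof eventually_elim
      case (elim s)
      then have "\<phi> (c s) \<in> \<phi> ` (U \<inter> M)" using e(2) by blast
      then show ?case unfolding img by blast
    qed
    have "(\<phi> has_derivative frechet_derivative \<phi> (at x)) (at (c 0))"
      using smooth(1) U c0 by (simp add: smooth_on_imp_has_derivative)
    then have D\<phi>: "((\<lambda>s. \<phi> (c s)) has_vector_derivative ?w) (at 0)"
      by (rule has_vector_derivative_compose[OF c'])
    \<comment> \<open>The velocity is a limit of difference quotients in \<open>W\<close>, and a
      subspace of a Euclidean space is closed.\<close>
    have "?w \<in> W"
    proof (rule Lim_in_closed_set[OF closed_subspace[OF W]])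
      show "((\<lambda>s. (1 / s) *\<^sub>R (\<phi> (c s) - ?p)) \<longlongrightarrow> ?w) (at 0)"
        using has_vector_derivative_quotient_tendsto[OF D\<phi>] c0 by simp
      show "\<forall>\<^sub>F s in at 0. (1 / s) *\<^sub>R (\<phi> (c s) - ?p) \<in> W"
        using ev_W by eventually_elim (use p W in \<open>simp add: subspace_diff subspace_scale\<close>)
    qed simp
    \<comment> \<open>Near 0 the composite of chart, inverse chart and curve is the curve itself;
      uniqueness of derivatives identifies the two velocities.\<close>
    moreover have "?D ?w = v"
    proof -
      have "((\<lambda>s. \<psi> (\<phi> (c s))) has_vector_derivative ?D ?w) (at 0)"
        by (rule has_vector_derivative_compose[OF D\<phi>]) (use D\<psi> c0 in simp)
      moreover have "\<psi> (\<phi> (c 0)) = c 0" using U c0 inv by simp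
      moreover have "\<forall>\<^sub>F s in at 0. \<psi> (\<phi> (c s)) = c s"
        using ev_U by eventually_elim (rule inv)
      ultimately have "\<forall>\<^sub>F s in nhds 0. \<psi> (\<phi> (c s)) = c s" "\<psi> (\<phi> (c 0)) = c 0"
        and "((\<lambda>s. \<psi> (\<phi> (c s))) has_vector_derivative ?D ?w) (at 0)"
        by (simp_all add: eventually_nhds_conv_at)
      then have "(c has_vector_derivative ?D ?w) (at 0)"
        using has_vector_derivative_cong_ev[of UNIV "\<lambda>s. \<psi> (\<phi> (c s))" c 0] by simp
      then show ?thesis using c' vector_derivative_unique_at by blast
    qed
    ultimately show ?thesis by force
  qed
  ultimately have "tangent_space M x = ?D ` W" by blast
  then show ?thesis by (rule that[OF has_derivative_linear[OF D\<psi>] W])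
qed

text \<open>Closure under addition is not visible from the definition by curves; it comes from the
  chart description.\<close>

corollary subspace_tangent_space:
  assumes "embedded_submanifold M d" "x \<in> M"
  shows "subspace (tangent_space M x)"
  using tangent_space_chart[OF assms] by (metis linear_subspace_image)

section \<open>Riemannian gradients\<close>

text \<open>Models a metric at a single point, with \<open>S\<close> the tangent space. The values
  of \<open>b\<close> off \<open>S\<close> are arbitrary, hence the membership premises in every
  rule.\<close>

locale inner_on =
  fixes S :: "'a::euclidean_space set" and b :: "'a \<Rightarrow> 'a \<Rightarrow> real"
  assumes sub: "subspace S"
    and comb_left: "\<And>u v w p q. u \<in> S \<Longrightarrow> v \<in> S \<Longrightarrow> w \<in> S \<Longrightarrow>
      b (p *\<^sub>R u + q *\<^sub>R v) w = p * b u w + q * b v w"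
    and sym: "\<And>u v. u \<in> S \<Longrightarrow> v \<in> S \<Longrightarrow> b u v = b v u"
    and pos: "\<And>u. u \<in> S \<Longrightarrow> u \<noteq> 0 \<Longrightarrow> b u u > 0"
begin

lemma add_left: "u \<in> S \<Longrightarrow> v \<in> S \<Longrightarrow> w \<in> S \<Longrightarrow> b (u + v) w = b u w + b v w"
  using comb_left[of u v w 1 1] by simp

lemma diff_left: "u \<in> S \<Longrightarrow> v \<in> S \<Longrightarrow> w \<in> S \<Longrightarrow> b (u - v) w = b u w - b v w"
  using comb_left[of u v w 1 "-1"] by simp

lemma scale_left: "u \<in> S \<Longrightarrow> w \<in> S \<Longrightarrow> b (p *\<^sub>R u) w = p * b u w"
  using comb_left[of u u w p 0] by simp

lemma comb_right:
  assumes "u \<in> S" "v \<in> S" "w \<in> S"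
  shows "b w (p *\<^sub>R u + q *\<^sub>R v) = p * b w u + q * b w v"
  using assms sub comb_left[of u v w p q] by (simp add: sym subspace_add subspace_scale)

lemma add_right: "u \<in> S \<Longrightarrow> v \<in> S \<Longrightarrow> w \<in> S \<Longrightarrow> b w (u + v) = b w u + b w v"
  using comb_right[of u v w 1 1] by simp

lemma diff_right: "u \<in> S \<Longrightarrow> v \<in> S \<Longrightarrow> w \<in> S \<Longrightarrow> b w (u - v) = b w u - b w v"
  using comb_right[of u v w 1 "-1"] by simp

lemma scale_right: "u \<in> S \<Longrightarrow> w \<in> S \<Longrightarrow> b w (p *\<^sub>R u) = p * b w u"
  using comb_right[of u u w p 0] by simp

lemma nonneg: "u \<in> S \<Longrightarrow> b u u \<ge> 0"
  using pos[of u] scale_left[of 0 0 0] sub by (cases "u = 0") (auto simp: subspace_0)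

lemma norm_scale:
  assumes "u \<in> S"
  shows "sqrt (b (p *\<^sub>R u) (p *\<^sub>R u)) = \<bar>p\<bar> * sqrt (b u u)"
proof -
  have "b (p *\<^sub>R u) (p *\<^sub>R u) = p\<^sup>2 * b u u"
    using assms sub by (simp add: scale_left scale_right subspace_scale power2_eq_square)
  then show ?thesis by (simp add: real_sqrt_mult)
qed

lemma Cauchy_Schwarz:
  assumes "u \<in> S" "v \<in> S"
  shows "\<bar>b u v\<bar> \<le> sqrt (b u u) * sqrt (b v v)"
proof (cases "v = 0")
  case True
  then have "b u v = 0" using scale_right[of u u 0] assms by simp
  then show ?thesis using nonneg assms by simp
next
  case False
  \<comment> \<open>Up to the factor \<open>b v v\<close>, this is the component of \<open>u\<close>
    orthogonal to \<open>v\<close>; the factor clears the denominator.\<close>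
  define w where "w = b v v *\<^sub>R u - b u v *\<^sub>R v"
  have "0 \<le> b w w" using assms sub
    by (intro nonneg) (simp add: w_def subspace_diff subspace_scale)
  also have "b w w = b v v * (b v v * b u u - (b u v)\<^sup>2)"
    using assms sub by (simp add: w_def diff_left diff_right scale_left scale_right subspace_scale
      subspace_diff sym[of v u] power2_eq_square algebra_simps)
  finally have "(b u v)\<^sup>2 \<le> b u u * b v v"
    using pos[OF assms(2) False] by (simp add: zero_le_mult_iff mult.commute)
  then have "sqrt ((b u v)\<^sup>2) \<le> sqrt (b u u * b v v)" by (rule real_sqrt_le_mono)
  then show ?thesis by (simp add: real_sqrt_mult)
qed

lemma norm_triangle:
  assumes "u \<in> S" "v \<in> S"
  shows "sqrt (b (u + v) (u + v)) \<le> sqrt (b u u) + sqrt (b v v)"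
proof (rule real_le_lsqrt)
  have "b (u + v) (u + v) = b u u + 2 * b u v + b v v"
    using assms sub by (simp add: add_left add_right subspace_add sym[of v u])
  also have "\<dots> \<le> (sqrt (b u u) + sqrt (b v v))\<^sup>2"
    using Cauchy_Schwarz[OF assms] nonneg[OF assms(1)] nonneg[OF assms(2)] by (simp add: power2_sum)
  finally show "b (u + v) (u + v) \<le> (sqrt (b u u) + sqrt (b v v))\<^sup>2" .
qed (use nonneg assms in auto)

text \<open>Gram--Schmidt: the representing vector is corrected by the \<open>b\<close>-orthogonal part of each new
  basis vector.\<close>

lemma representing_vector_on_basis:
  assumes "finite B" "independent B" "B \<subseteq> S"
  shows "\<exists>u\<in>span B. \<forall>v\<in>B. b u v = D v"
  using assms
proof (induction B arbitrary: D rule: finite_induct)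
  case empty
  then show ?case by simp
next
  case (insert c B)
  then have c: "c \<notin> span B" "c \<in> S" and B: "independent B" "B \<subseteq> S"
    by (auto simp: independent_insert)
  have spanS: "span B \<subseteq> S" using B(2) sub by (simp add: span_minimal)
  obtain u where u: "u \<in> span B" "\<forall>v\<in>B. b u v = D v" using insert.IH B by blast
  \<comment> \<open>Here the induction hypothesis is applied to the functional \<open>b c\<close>:
    \<open>p\<close> is the orthogonal projection of \<open>c\<close> onto
    \<open>span B\<close>.\<close>
  obtain p where p: "p \<in> span B" "\<forall>v\<in>B. b p v = b c v" using insert.IH B by blast
  define q where "q = c - p"
  have uS: "u \<in> S" and pS: "p \<in> S" using u p spanS by auto
  have qS: "q \<in> S" using pS c sub by (simp add: q_def subspace_diff)
  have qB: "b q v = 0" if "v \<in> B" for v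
    using p that c pS B by (auto simp: q_def diff_left)
  \<comment> \<open>Orthogonality to \<open>B\<close> extends to its span. Membership in
    \<open>S\<close> is carried along because additivity of \<open>b\<close> requires it.\<close>
  have "p \<in> S \<and> b q p = 0"
    using p(1)
  proof (induction rule: span_induct_alt)
    case base
    then show ?case using scale_right[of q q 0] qS sub by (simp add: subspace_0)
  next
    case (step a v y)
    then show ?case using B qS sub qB
      by (auto simp: add_right scale_right subset_iff subspace_scale subspace_add)
  qed
  then have "b q c = b q q" using pS qS c by (simp add: q_def diff_right)
  moreover have "q \<noteq> 0" using p c by (auto simp: q_def)
  ultimately have "b q c > 0" using pos qS by simp
  \<comment> \<open>Chosen so that \<open>u + a *\<^sub>R q\<close> takes the value
    \<open>D c\<close> against \<open>c\<close>; the values on \<open>B\<close> are unchanged since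
    \<open>q\<close> is orthogonal to \<open>B\<close>.\<close>
  define a where "a = (D c - b u c) / b q c"
  have "b (u + a *\<^sub>R q) v = D v" if "v \<in> insert c B" for v
    using that uS qS c B u(2) qB sub \<open>b q c > 0\<close>
    by (auto simp: add_left scale_left subspace_scale a_def)
  moreover have "u + a *\<^sub>R q \<in> span (insert c B)"
    using u p unfolding q_def
    by (intro span_add span_scale span_diff span_base[of c]) (auto intro: span_mono[THEN subsetD])
  ultimately show ?case by blast
qed

text \<open>Riesz representation in finite dimension. Existence extends from a basis by linearity;
  for uniqueness, the difference of two representing vectors is orthogonal to itself.\<close>

lemma representing_vector:
  assumes "linear D"
  shows "\<exists>!u. u \<in> S \<and> (\<forall>v\<in>S. b u v = D v)"
proof -
  obtain B where B: "B \<subseteq> S" "independent B" "S \<subseteq> span B" "finite B"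
    using maximal_independent_subset[of S] by (metis independent_imp_finite)
  obtain u where u: "u \<in> span B" "\<forall>v\<in>B. b u v = D v"
    using representing_vector_on_basis[OF B(4,2,1)] by blast
  have S: "span B = S" using B sub by (simp add: span_minimal subset_antisym)
  have "v \<in> S \<and> b u v = D v" if "v \<in> span B" for v
    using that
  proof (induction rule: span_induct_alt)
    case base
    then show ?case using scale_right[of u u 0] u S linear_0[OF assms] sub
      by (simp add: subspace_0)
  next
    case (step a v y)
    then show ?case using u S B sub linear_add[OF assms] linear_scale[OF assms]
      by (auto simp: add_right scale_right subset_iff subspace_scale subspace_add)
  qed
  moreover have "u = u'" if "u' \<in> S" "\<forall>v\<in>S. b u' v = D v" "u \<in> S" "\<forall>v\<in>S. b u v = D v" for u'
  proof -
    have "b (u - u') (u - u') = 0" using that sub by (simp add: diff_left subspace_diff)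
    then show ?thesis using pos[of "u - u'"] that sub by (force simp: subspace_diff)
  qed
  ultimately show ?thesis using u S by blast
qed

end

lemma riemannian_metric_inner_on:
  assumes "embedded_submanifold M d" "riemannian_metric M g" "x \<in> M"
  shows "inner_on (tangent_space M x) (g x)"
  using assms subspace_tangent_space[OF assms(1,3)]
  by unfold_locales (auto simp: riemannian_metric_def)

section \<open>Differentials and gradients of functions on the manifold\<close>

text \<open>The derivative of \<open>f\<close> along a curve in \<open>M\<close> equals that of any
  local extension \<open>F\<close>, which the chain rule makes linear in the velocity and
  independent of the curve.\<close>

lemma Ck_extendable_differential:
  assumes "Ck_extendable_on 1 M f" "x \<in> M"
  obtains D :: "'a::euclidean_space \<Rightarrow> real"
  where "linear D" "\<And>\<xi>. \<xi> \<in> tangent_space M x \<Longrightarrow> manifold_differential M f x \<xi> = D \<xi>"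
proof -
  obtain U F where U: "open U" "x \<in> U" and F: "Ck_on 1 U F" and eq: "\<forall>q\<in>M \<inter> U. F q = f q"
    using assms by (auto simp: Ck_extendable_on_def)
  let ?D = "frechet_derivative F (at x)"
  have D: "(F has_derivative ?D) (at x)"
    using F U by (simp flip: frechet_derivative_works)
  have deriv: "((\<lambda>s. f (c s)) has_real_derivative ?D \<xi>) (at 0)" if c: "curve_through M x \<xi> c" for \<xi> c
  proof -
    obtain e where e: "e > 0" "c ` {-e<..<e} \<subseteq> M" and c0: "c 0 = x"
      and c': "(c has_vector_derivative \<xi>) (at 0)"
      using c by (auto simp: curve_through_def)
    have "continuous (at 0) c" using c' by (rule has_vector_derivative_continuous)
    then have ev_U: "\<forall>\<^sub>F s in nhds 0. c s \<in> U"
      using U c0 by (simp add: continuous_at_open eventually_nhds)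
    have "\<forall>\<^sub>F s in nhds (0::real). s \<in> {-e<..<e}"
      using e by (intro eventually_nhds_in_open) auto
    with ev_U have ev: "\<forall>\<^sub>F s in nhds 0. F (c s) = f (c s)"
    proof eventually_elim
      case (elim s)
      then have "c s \<in> M \<inter> U" using e(2) by blast
      then show ?case by (rule eq[rule_format])
    qed
    have "((\<lambda>s. F (c s)) has_vector_derivative ?D \<xi>) (at 0)"
      by (rule has_vector_derivative_compose[OF c']) (use D c0 in simp)
    then have "((\<lambda>s. F (c s)) has_real_derivative ?D \<xi>) (at 0)"
      by (simp add: has_real_derivative_iff_has_vector_derivative)
    then show ?thesis using DERIV_cong_ev[OF refl ev refl] by blast
  qed
  have "manifold_differential M f x \<xi> = ?D \<xi>" if \<xi>: "\<xi> \<in> tangent_space M x" for \<xi>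
    unfolding manifold_differential_def
  proof (rule the_equality)
    \<comment> \<open>Uniqueness requires at least one curve with velocity \<open>\<xi>\<close>;
      membership in the tangent space supplies it.\<close>
    fix E assume "\<forall>c. curve_through M x \<xi> c \<longrightarrow> ((\<lambda>s. f (c s)) has_real_derivative E) (at 0)"
    with \<xi> deriv show "E = ?D \<xi>" by (auto simp: tangent_space_def intro: DERIV_unique)
  qed (use deriv in blast)
  moreover have "linear ?D" using D has_derivative_linear by blast
  ultimately show ?thesis using that by blast
qed

text \<open>Riesz representation of the differential makes the definite description in
  \<open>riem_grad\<close> denote a vector. Membership admits the gradient to the estimates of
  \<open>inner_on\<close>.\<close>

lemma riem_grad_in_tangent_space:
  assumes "embedded_submanifold M d" "riemannian_metric M g" "Ck_extendable_on 1 M f" "x \<in> M"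
  shows "riem_grad M g f x \<in> tangent_space M x"
proof -
  interpret inner_on "tangent_space M x" "g x"
    using assms by (rule_tac riemannian_metric_inner_on)
  obtain D where D: "linear D"
    "\<And>\<xi>. \<xi> \<in> tangent_space M x \<Longrightarrow> manifold_differential M f x \<xi> = D \<xi>"
    using Ck_extendable_differential[OF assms(3,4)] by blast
  have "\<exists>!v. v \<in> tangent_space M x \<and>
      (\<forall>\<xi>\<in>tangent_space M x. g x v \<xi> = manifold_differential M f x \<xi>)"
    using representing_vector[OF D(1)] D(2) by simp
  from theI'[OF this] show ?thesis unfolding riem_grad_def by blast
qed

lemma Ck_extendable_tendsto:
  assumes "Ck_extendable_on 1 M f" "p \<in> M" "y \<longlonglongrightarrow> p" "\<forall>\<^sub>F k in sequentially. y k \<in> M"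
  shows "(\<lambda>k. f (y k)) \<longlonglongrightarrow> f p"
proof -
  obtain U F where U: "open U" "p \<in> U" and F: "Ck_on 1 U F" and eq: "\<forall>q\<in>M \<inter> U. F q = f q"
    using assms by (auto simp: Ck_extendable_on_def)
  have "isCont F p" using F U by (simp add: differentiable_imp_continuous_within)
  then have "(\<lambda>k. F (y k)) \<longlonglongrightarrow> F p" using assms(3) by (rule isCont_tendsto_compose)
  moreover have "\<forall>\<^sub>F k in sequentially. y k \<in> U" using assms(3) U by (simp add: topological_tendstoD)
  with assms(4) have "\<forall>\<^sub>F k in sequentially. F (y k) = f (y k)"
    by eventually_elim (use eq in simp)
  ultimately show ?thesis using eq assms(2) U by (simp add: tendsto_cong)
qed

text \<open>Cauchy-Schwarz and the relative error give
  \<open>b G h \<ge> (1 - \<nu>) * b G G\<close>, and the triangle inequality gives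
  \<open>b h h \<le> (1 + \<nu>)\<^sup>2 * b G G\<close>. The upper bound on \<open>s\<close> then
  lets the quadratic term absorb the linear one except for the share
  \<open>\<delta> / 2\<close>.\<close>

lemma inexact_gradient_descent:
  assumes "inner_on S b" "G \<in> S" "h \<in> S"
    and err: "sqrt (b (h - G) (h - G)) \<le> \<nu> * sqrt (b G G)"
    and "0 \<le> s" "s \<le> (2 - 2 * \<nu> - \<delta>) / (L * (1 + \<nu>)\<^sup>2)" "L > 0" "0 \<le> \<nu>"
  shows "sqrt (b h h) \<le> (1 + \<nu>) * sqrt (b G G)"
    and "b G (- s *\<^sub>R h) + L / 2 * (sqrt (b (- s *\<^sub>R h) (- s *\<^sub>R h)))\<^sup>2 \<le> - (\<delta> / 2 * s * b G G)"
proof -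
  interpret inner_on S b by fact
  have hG: "h - G \<in> S" using assms sub by (simp add: subspace_diff)
  show nh: "sqrt (b h h) \<le> (1 + \<nu>) * sqrt (b G G)"
    using norm_triangle[OF assms(2) hG] err by (simp add: algebra_simps)
  have GG: "b G G \<ge> 0" using nonneg assms by simp
  have hh: "b h h \<le> (1 + \<nu>)\<^sup>2 * b G G"
  proof -
    have "(sqrt (b h h))\<^sup>2 \<le> ((1 + \<nu>) * sqrt (b G G))\<^sup>2"
      using nh nonneg[OF assms(3)] by (intro power_mono) auto
    then show ?thesis using GG nonneg[OF assms(3)] by (simp add: power_mult_distrib)
  qed
  have "\<bar>b G (h - G)\<bar> \<le> sqrt (b G G) * (\<nu> * sqrt (b G G))"
    using Cauchy_Schwarz[OF assms(2) hG] err GG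
    by (meson mult_left_mono order_trans real_sqrt_ge_zero)
  then have "\<bar>b G h - b G G\<bar> \<le> \<nu> * b G G"
    using assms GG by (simp add: diff_right algebra_simps)
  then have Gh: "(1 - \<nu>) * b G G \<le> b G h" by (simp add: algebra_simps)
  have sL: "s * (L * (1 + \<nu>)\<^sup>2) \<le> 2 - 2 * \<nu> - \<delta>"
    using assms by (subst (asm) pos_le_divide_eq) auto
  have "(sqrt (b (- s *\<^sub>R h) (- s *\<^sub>R h)))\<^sup>2 = s * s * b h h"
    unfolding norm_scale[OF assms(3)]
    using nonneg[OF assms(3)] by (simp add: power_mult_distrib flip: power2_eq_square)
  then have "b G (- s *\<^sub>R h) + L / 2 * (sqrt (b (- s *\<^sub>R h) (- s *\<^sub>R h)))\<^sup>2
      = - s * b G h + L / 2 * s * s * b h h"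
    using scale_right[OF assms(3,2), of "- s"] by simp
  also have "\<dots> \<le> - s * ((1 - \<nu>) * b G G) + L / 2 * s * s * ((1 + \<nu>)\<^sup>2 * b G G)"
    using Gh hh assms by (intro add_mono mult_left_mono_neg mult_left_mono) auto
  also have "\<dots> = s * b G G / 2 * (s * (L * (1 + \<nu>)\<^sup>2) - (2 - 2 * \<nu>))"
    by (simp add: field_simps)
  also have "\<dots> \<le> s * b G G / 2 * (- \<delta>)"
    using sL GG assms by (intro mult_left_mono) auto
  finally show "b G (- s *\<^sub>R h) + L / 2 * (sqrt (b (- s *\<^sub>R h) (- s *\<^sub>R h)))\<^sup>2
      \<le> - (\<delta> / 2 * s * b G G)" by (simp add: mult_ac)
qed

section \<open>Convergence under the Kurdyka--Lojasiewicz inequality\<close>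

text \<open>A concave function lies below its tangents. The point of tangency \<open>r\<close> must
  be interior to the domain, whereas \<open>s\<close> may be the endpoint 0.\<close>

lemma desingularizing_above_tangent:
  assumes "desingularizing \<delta> \<phi>" "0 < r" "ereal r < \<delta>" "0 \<le> s" "ereal s < \<delta>"
  shows "\<phi> s \<le> \<phi> r + deriv \<phi> r * (s - r)"
proof -
  let ?A = "{t. 0 \<le> t \<and> ereal t < \<delta>}"
  have conv: "convex_on ?A (\<lambda>t. - \<phi> t)"
    using assms(1) by (simp add: desingularizing_def concave_on_def)
  have "open {t. ereal t < \<delta>}"
    by (intro open_Collect_less continuous_intros)
  then have "open ({0<..} \<inter> {t. ereal t < \<delta>})" by (rule open_Int[OF open_greaterThan])
  moreover have "r \<in> {0<..} \<inter> {t. ereal t < \<delta>}" using assms(2,3) by simp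
  moreover have "{0<..} \<inter> {t. ereal t < \<delta>} \<subseteq> ?A" by auto
  ultimately have "r \<in> interior ?A" by (rule interiorI)
  moreover have "(\<phi> has_real_derivative deriv \<phi> r) (at r)"
    using assms by (simp add: desingularizing_def DERIV_deriv_iff_real_differentiable)
  then have "((\<lambda>t. - \<phi> t) has_real_derivative - deriv \<phi> r) (at r within ?A)"
    by (rule DERIV_minus[OF has_field_derivative_at_within])
  ultimately have "- \<phi> s - - \<phi> r \<ge> - deriv \<phi> r * (s - r)"
    using assms(4,5) convex_connected[OF convex_on_imp_convex[OF conv]]
    by (intro convex_on_imp_above_tangent[OF conv]) auto
  then show ?thesis by simp
qed

text \<open>\<open>r\<close> is the gap between the current and the limiting function value, \<open>h\<close> the stepsize times the
  gradient norm \<open>G\<close>.\<close>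

locale KL_descent =
  fixes x :: "nat \<Rightarrow> 'a::metric_space" and xbar :: 'a
    and r h G :: "nat \<Rightarrow> real" and a b \<epsilon> :: real and K :: nat
    and \<phi> :: "real \<Rightarrow> real" and \<delta> :: ereal
  assumes desing: "desingularizing \<delta> \<phi>" and \<delta>: "0 < \<delta>"
    and r_pos: "\<And>k. k \<ge> K \<Longrightarrow> r k > 0" and r_lim: "r \<longlonglongrightarrow> 0"
    and a_pos: "a > 0" and b_pos: "b > 0" and \<epsilon>: "\<epsilon> > 0"
    and h_nonneg: "\<And>k. k \<ge> K \<Longrightarrow> h k \<ge> 0" and G_nonneg: "\<And>k. k \<ge> K \<Longrightarrow> G k \<ge> 0"
    and desc: "\<And>k. k \<ge> K \<Longrightarrow> a * h k * G k \<le> r k - r (Suc k)"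
    and step: "\<And>k. k \<ge> K \<Longrightarrow> dist (x (Suc k)) (x k) \<le> b * h k"
    and KL: "\<And>k. k \<ge> K \<Longrightarrow> dist (x k) xbar < \<epsilon> \<Longrightarrow> ereal (r k) < \<delta> \<Longrightarrow>
      deriv \<phi> (r k) * G k \<ge> 1"
    and acc: "\<exists>\<sigma>. strict_mono \<sigma> \<and> (x \<circ> \<sigma>) \<longlonglongrightarrow> xbar"
begin

lemma r_Suc_le:
  assumes "k \<ge> K"
  shows "r (Suc k) \<le> r k"
proof -
  have "0 \<le> a * h k * G k" using h_nonneg[OF assms] G_nonneg[OF assms] a_pos by simp
  then show ?thesis using desc[OF assms] by linarith
qed

text \<open>Stated as a sum so that successive steps telescope. The drop of \<open>\<phi>\<close> is
  estimated from below by concavity.\<close>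

lemma step_le_potential_drop:
  assumes "k \<ge> K" "dist (x k) xbar < \<epsilon>" "ereal (r k) < \<delta>"
  shows "dist (x (Suc k)) (x k) + b / a * \<phi> (r (Suc k)) \<le> b / a * \<phi> (r k)"
proof -
  have r: "0 < r k" "0 < r (Suc k)" using r_pos assms(1) by simp_all
  have "ereal (r (Suc k)) < \<delta>"
    using r_Suc_le[OF assms(1)] assms(3) le_less_trans[of "ereal (r (Suc k))" "ereal (r k)" \<delta>]
    by simp
  then have "\<phi> (r (Suc k)) \<le> \<phi> (r k) + deriv \<phi> (r k) * (r (Suc k) - r k)"
    using desingularizing_above_tangent[OF desing] assms(3) r by simp
  moreover have "a * h k \<le> deriv \<phi> (r k) * (r k - r (Suc k))"
  proof -
    \<comment> \<open>The KL inequality replaces 1 by \<open>deriv \<phi> (r k) * G k\<close>; this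
      produces the product \<open>h k * G k\<close> that the descent inequality controls.\<close>
    have "a * h k * 1 \<le> a * h k * (deriv \<phi> (r k) * G k)"
      using KL assms a_pos h_nonneg by (intro mult_left_mono) auto
    also have "\<dots> = deriv \<phi> (r k) * (a * h k * G k)" by simp
    also have "\<dots> \<le> deriv \<phi> (r k) * (r k - r (Suc k))"
      using desc[OF assms(1)] desing r assms(3)
      by (intro mult_left_mono) (auto simp: desingularizing_def less_imp_le)
    finally show ?thesis by simp
  qed
  ultimately have "a * h k + \<phi> (r (Suc k)) \<le> \<phi> (r k)" by (simp add: algebra_simps)
  then have "b / a * (a * h k + \<phi> (r (Suc k))) \<le> b / a * \<phi> (r k)"
    using a_pos b_pos by (intro mult_left_mono) auto
  then show ?thesis using step[OF assms(1)] a_pos by (simp add: distrib_left)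
qed

lemma phi_nonneg: "k \<ge> K \<Longrightarrow> ereal (r k) < \<delta> \<Longrightarrow> 0 \<le> \<phi> (r k)"
  using desing r_pos[of k] by (simp add: desingularizing_def)

text \<open>\<open>dist (x k) xbar + b / a * \<phi> (r k)\<close> decreases as long as the iterates stay in the KL
  neighborhood, which keeps them there.\<close>

lemma eventually_trapped:
  assumes "0 < e" "e \<le> \<epsilon>"
  shows "\<exists>k0\<ge>K. \<forall>k\<ge>k0. dist (x k) xbar < e \<and> ereal (r k) < \<delta>"
proof -
  obtain \<sigma> where \<sigma>: "strict_mono \<sigma>" "(x \<circ> \<sigma>) \<longlonglongrightarrow> xbar" using acc by blast
  have r_\<delta>: "\<forall>\<^sub>F k in sequentially. ereal (r k) < \<delta>"
  proof -
    have "(\<lambda>k. ereal (r k)) \<longlonglongrightarrow> ereal 0" using r_lim by (rule tendsto_ereal)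
    then show ?thesis by (rule order_tendstoD(2)) (use \<delta> in \<open>simp add: zero_ereal_def\<close>)
  qed
  have sub: "\<forall>\<^sub>F n in sequentially. P (\<sigma> n)" if "\<forall>\<^sub>F k in sequentially. P k" for P
    by (rule eventually_subseq[OF \<sigma>(1) that])
  have in_dom: "\<forall>\<^sub>F n in sequentially. K \<le> \<sigma> n \<and> ereal (r (\<sigma> n)) < \<delta>"
    using sub[OF eventually_conj[OF eventually_ge_at_top r_\<delta>]] by simp
  \<comment> \<open>Continuity is used at the endpoint 0 of the domain, so the gaps have to be shown
    to lie in the domain eventually.\<close>
  have "(\<lambda>n. \<phi> (r (\<sigma> n))) \<longlonglongrightarrow> \<phi> 0"
  proof (rule continuous_on_tendsto_compose[where f = \<phi> and l = 0
      and g = "\<lambda>n. r (\<sigma> n)"])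
    show "continuous_on {t. 0 \<le> t \<and> ereal t < \<delta>} \<phi>"
      using desing by (simp add: desingularizing_def)
    show "(\<lambda>n. r (\<sigma> n)) \<longlonglongrightarrow> 0" using LIMSEQ_subseq_LIMSEQ[OF r_lim \<sigma>(1)] by (simp add: o_def)
    show "\<forall>\<^sub>F n in sequentially. r (\<sigma> n) \<in> {t. 0 \<le> t \<and> ereal t < \<delta>}"
      using in_dom by eventually_elim (simp add: r_pos less_imp_le)
  qed (use \<delta> in \<open>auto simp: zero_ereal_def\<close>)
  then have "(\<lambda>n. b / a * \<phi> (r (\<sigma> n))) \<longlonglongrightarrow> b / a * \<phi> 0" by (rule tendsto_mult_left)
  moreover have "(\<lambda>n. dist (x (\<sigma> n)) xbar) \<longlonglongrightarrow> 0"
    using \<sigma>(2) by (subst (asm) tendsto_dist_iff) (simp add: o_def)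
  ultimately have "(\<lambda>n. dist (x (\<sigma> n)) xbar + b / a * \<phi> (r (\<sigma> n))) \<longlonglongrightarrow> 0 + b / a * \<phi> 0"
    using tendsto_add by blast
  moreover have "0 + b / a * \<phi> 0 < e" using desing assms by (simp add: desingularizing_def)
  ultimately have "\<forall>\<^sub>F n in sequentially. dist (x (\<sigma> n)) xbar + b / a * \<phi> (r (\<sigma> n)) < e"
    by (rule order_tendstoD(2))
  with in_dom have "\<forall>\<^sub>F n in sequentially. K \<le> \<sigma> n \<and> ereal (r (\<sigma> n)) < \<delta> \<and>
      dist (x (\<sigma> n)) xbar + b / a * \<phi> (r (\<sigma> n)) < e"
    by eventually_elim simp
  then obtain n where "K \<le> \<sigma> n \<and> ereal (r (\<sigma> n)) < \<delta> \<and>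
      dist (x (\<sigma> n)) xbar + b / a * \<phi> (r (\<sigma> n)) < e"
    using eventually_happens'[OF sequentially_bot] by blast
  then obtain k0 where k0: "k0 \<ge> K" "ereal (r k0) < \<delta>" "dist (x k0) xbar + b / a * \<phi> (r k0) < e"
    by blast
  \<comment> \<open>The induction bounds the whole potential, since the distance alone may grow from
    one step to the next.\<close>
  have trapped: "ereal (r k) < \<delta> \<and> dist (x k) xbar + b / a * \<phi> (r k) < e" if "k \<ge> k0" for k
    using that
  proof (induction rule: dec_induct)
    case (step k)
    have K: "k \<ge> K" using step k0 by simp
    have "0 \<le> b / a * \<phi> (r k)" using phi_nonneg[OF K] step a_pos b_pos by simp
    then have "dist (x k) xbar < \<epsilon>" using step assms by simp
    with K step have "dist (x (Suc k)) (x k) + b / a * \<phi> (r (Suc k)) \<le> b / a * \<phi> (r k)"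
      by (intro step_le_potential_drop) auto
    moreover have "dist (x (Suc k)) xbar \<le> dist (x (Suc k)) (x k) + dist (x k) xbar"
      by (rule dist_triangle)
    ultimately have "dist (x (Suc k)) xbar + b / a * \<phi> (r (Suc k)) < e"
      using step by linarith
    moreover have "ereal (r (Suc k)) < \<delta>"
      using step r_Suc_le[OF K] le_less_trans[of "ereal (r (Suc k))" "ereal (r k)" \<delta>] by simp
    ultimately show ?case by simp
  qed (use k0 in simp)
  have "dist (x k) xbar < e \<and> ereal (r k) < \<delta>" if "k \<ge> k0" for k
  proof -
    have "0 \<le> b / a * \<phi> (r k)" using phi_nonneg[of k] trapped[OF that] that k0(1) a_pos b_pos by simp
    then show ?thesis using trapped[OF that] by simp
  qed
  then show ?thesis using k0(1) by blast
qed

lemma converges: "x \<longlonglongrightarrow> xbar"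
proof (rule metric_LIMSEQ_I)
  fix e :: real assume "e > 0"
  then obtain k0 where "\<forall>k\<ge>k0. dist (x k) xbar < min e \<epsilon>"
    using eventually_trapped[of "min e \<epsilon>"] \<epsilon> by auto
  then show "\<exists>k0. \<forall>k\<ge>k0. dist (x k) xbar < e" by auto
qed

text \<open>Telescoping the step bound from \<open>k\<close> to \<open>m\<close> and dropping the
  nonnegative last potential bounds \<open>dist (x k) (x m)\<close> uniformly in \<open>m\<close>;
  then \<open>m\<close> tends to infinity.\<close>

lemma eventually_dist_le_phi:
  "\<exists>k0\<ge>K. \<forall>k\<ge>k0. dist (x k) xbar \<le> b / a * \<phi> (r k) \<and> deriv \<phi> (r k) * G k \<ge> 1"
proof -
  obtain k0 where k0: "k0 \<ge> K" "\<And>k. k \<ge> k0 \<Longrightarrow> dist (x k) xbar < \<epsilon> \<and> ereal (r k) < \<delta>"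
    using eventually_trapped[of \<epsilon>] \<epsilon> by auto
  have "dist (x k) xbar \<le> b / a * \<phi> (r k)" if k: "k \<ge> k0" for k
  proof (rule LIMSEQ_le_const2)
    show "(\<lambda>m. dist (x k) (x m)) \<longlonglongrightarrow> dist (x k) xbar"
      by (intro tendsto_intros converges)
    have "dist (x k) (x m) + b / a * \<phi> (r m) \<le> b / a * \<phi> (r k)" if "m \<ge> k" for m
      using that
    proof (induction rule: dec_induct)
      case (step m)
      have "dist (x (Suc m)) (x m) + b / a * \<phi> (r (Suc m)) \<le> b / a * \<phi> (r m)"
        using k0 k step by (intro step_le_potential_drop) auto
      then show ?case
        using step dist_triangle2[of "x k" "x (Suc m)" "x m"] by (simp add: dist_commute)
    qed simp
    moreover have "0 \<le> b / a * \<phi> (r m)" if "m \<ge> k" for m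
      using phi_nonneg[of m] k0 k that a_pos b_pos by simp
    ultimately have "dist (x k) (x m) \<le> b / a * \<phi> (r k)" if "m \<ge> k" for m
      using that by (meson add_increasing2 order_trans order.refl)
    then show "\<exists>N. \<forall>m\<ge>N. dist (x k) (x m) \<le> b / a * \<phi> (r k)" by blast
  qed
  moreover have "deriv \<phi> (r k) * G k \<ge> 1" if "k \<ge> k0" for k
    using k0 that by (intro KL) auto
  ultimately show ?thesis using k0(1) by blast
qed

end

section \<open>Rates for power desingularizing functions\<close>

lemma deriv_powr_desingularizer:
  fixes C \<theta> r :: real
  assumes "r > 0" "\<theta> > 0"
  shows "deriv (\<lambda>s. C / \<theta> * s powr \<theta>) r = C * r powr (\<theta> - 1)"
  using assms by (intro DERIV_imp_deriv) (auto intro!: derivative_eq_intros)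

text \<open>With \<open>h k\<close> the stepsize times \<open>G k\<close>, the constant
  \<open>\<tau>\<close> is a lower bound on the stepsizes; it turns the descent inequality into a
  decrease of order \<open>(G k)\<^sup>2\<close>.\<close>

locale KL_descent_powr = KL_descent where \<phi> = "\<lambda>s. C / \<theta> * s powr \<theta>" for C \<theta> :: real +
  fixes \<tau> :: real
  assumes C_pos: "C > 0" and \<theta>: "0 < \<theta>" "\<theta> \<le> 1" and \<tau>_pos: "\<tau> > 0"
    and h_lower: "\<And>k. k \<ge> K \<Longrightarrow> \<tau> * G k \<le> h k"
begin

text \<open>The KL inequality now reads \<open>G k \<ge> r k powr (1 - \<theta>) / C\<close>. Its
  square, inserted into the descent inequality, gives a recursion in the gaps alone.\<close>

lemma eventually_gap_decrease:
  "\<exists>k0\<ge>K. \<forall>k\<ge>k0. dist (x k) xbar \<le> b / a * (C / \<theta> * r k powr \<theta>) \<and>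
     r (Suc k) \<le> r k - a * \<tau> / C\<^sup>2 * r k powr (2 - 2 * \<theta>)"
proof -
  obtain k0 where k0: "k0 \<ge> K" and dist: "\<forall>k\<ge>k0. dist (x k) xbar \<le> b / a * (C / \<theta> * r k powr \<theta>)"
    and grad: "\<forall>k\<ge>k0. deriv (\<lambda>s. C / \<theta> * s powr \<theta>) (r k) * G k \<ge> 1"
    using eventually_dist_le_phi by blast
  have "r (Suc k) \<le> r k - a * \<tau> / C\<^sup>2 * r k powr (2 - 2 * \<theta>)" if "k \<ge> k0" for k
  proof -
    have K: "k \<ge> K" and r: "r k > 0" using k0 that r_pos by auto
    have "1 \<le> C * r k powr (\<theta> - 1) * G k"
      using grad[rule_format, OF that] unfolding deriv_powr_desingularizer[OF r \<theta>(1)] .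
    then have "r k powr (1 - \<theta>) * 1 \<le> r k powr (1 - \<theta>) * (C * r k powr (\<theta> - 1) * G k)"
      by (intro mult_left_mono) auto
    also have "\<dots> = C * G k * (r k powr (1 - \<theta>) * r k powr (\<theta> - 1))" by simp
    also have "\<dots> = C * G k" using r by (simp flip: powr_add)
    finally have "r k powr (1 - \<theta>) / C \<le> G k"
      using C_pos by (simp add: divide_le_eq mult.commute)
    then have "(r k powr (1 - \<theta>) / C)\<^sup>2 \<le> (G k)\<^sup>2" using C_pos by (intro power_mono) auto
    moreover have "(r k powr (1 - \<theta>))\<^sup>2 = r k powr (2 - 2 * \<theta>)"
      using r by (simp add: power2_eq_square flip: powr_add)
    ultimately have "a * \<tau> * (r k powr (2 - 2 * \<theta>) / C\<^sup>2) \<le> a * \<tau> * (G k)\<^sup>2"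
      using a_pos \<tau>_pos by (intro mult_left_mono) (auto simp: power_divide)
    also have "\<dots> = a * (\<tau> * G k) * G k" by (simp add: power2_eq_square)
    also have "\<dots> \<le> a * h k * G k"
      using h_lower[OF K] G_nonneg[OF K] a_pos by (intro mult_right_mono mult_left_mono) auto
    also have "\<dots> \<le> r k - r (Suc k)" by (rule desc[OF K])
    finally show ?thesis by simp
  qed
  with k0 dist show ?thesis by blast
qed

text \<open>For \<open>\<theta> = 1\<close> the recursion lowers the gap by a fixed positive amount
  at every late step, which is impossible while the gaps stay positive and tend to 0.\<close>

lemma exponent_ne_1: "\<theta> \<noteq> 1"
proof
  assume "\<theta> = 1"
  obtain k0 where k0: "k0 \<ge> K"
    and dec: "\<forall>k\<ge>k0. r (Suc k) \<le> r k - a * \<tau> / C\<^sup>2 * r k powr (2 - 2 * \<theta>)"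
    using eventually_gap_decrease by blast
  have "\<forall>\<^sub>F k in sequentially. r k < a * \<tau> / C\<^sup>2"
    using r_lim a_pos \<tau>_pos C_pos by (intro order_tendstoD(2)) auto
  then have "\<forall>\<^sub>F k in sequentially. k \<ge> k0 \<and> r k < a * \<tau> / C\<^sup>2"
    by (intro eventually_conj eventually_ge_at_top)
  then obtain k where k: "k \<ge> k0" "r k < a * \<tau> / C\<^sup>2"
    using eventually_happens by fastforce
  \<comment> \<open>Positivity of \<open>r k\<close> matters here: \<open>r k powr 0\<close> is 1
    only for nonzero \<open>r k\<close>.\<close>
  have "r (Suc k) \<le> r k - a * \<tau> / C\<^sup>2"
    using dec k(1) r_pos[of k] k0 \<open>\<theta> = 1\<close> by force
  then show False using k r_pos[of "Suc k"] k0 by simp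
qed

text \<open>Once the gap is below 1, the exponent \<open>2 - 2 * \<theta> \<le> 1\<close> gives
  \<open>r k \<le> r k powr (2 - 2 * \<theta>)\<close>. The gaps then contract by the factor
  \<open>1 - c\<close>, and the distances by its power \<open>\<theta>\<close>.\<close>

lemma linear_rate:
  assumes "1 / 2 \<le> \<theta>"
  shows "\<exists>Cr>0. \<exists>Q. 0 \<le> Q \<and> Q < 1 \<and> (\<forall>k. dist (x k) xbar < Cr * Q ^ k)"
proof -
  define c where "c = a * \<tau> / C\<^sup>2"
  have c_pos: "c > 0" using a_pos \<tau>_pos C_pos by (simp add: c_def)
  obtain k0 where k0: "k0 \<ge> K"
    and dist: "\<And>k. k \<ge> k0 \<Longrightarrow> dist (x k) xbar \<le> b / a * (C / \<theta> * r k powr \<theta>)"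
    and dec: "\<And>k. k \<ge> k0 \<Longrightarrow> r (Suc k) \<le> r k - c * r k powr (2 - 2 * \<theta>)"
    using eventually_gap_decrease unfolding c_def by blast
  have "\<forall>\<^sub>F k in sequentially. r k < 1" using r_lim by (intro order_tendstoD(2)) auto
  then obtain k' where k': "\<forall>k\<ge>k'. r k < 1" unfolding eventually_sequentially by blast
  define k1 where "k1 = max k0 k'"
  have k1: "k1 \<ge> k0" "\<And>k. k \<ge> k1 \<Longrightarrow> r k < 1" using k' by (auto simp: k1_def)
  have r1: "0 < r k" if "k \<ge> k1" for k using r_pos that k0 k1(1) by simp
  have contr: "r (Suc k) \<le> (1 - c) * r k" if "k \<ge> k1" for k
  proof -
    have "r k powr 1 \<le> r k powr (2 - 2 * \<theta>)"
      using assms r1[OF that] k1(2)[OF that] by (intro powr_mono') auto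
    then have "c * r k \<le> c * r k powr (2 - 2 * \<theta>)"
      using c_pos r1[OF that] by (intro mult_left_mono) auto
    then show ?thesis using dec[of k] that k1(1) by (simp add: algebra_simps)
  qed
  \<comment> \<open>The bound \<open>c < 1\<close> is forced by the positivity of the next
    gap.\<close>
  have "0 < (1 - c) * r k1" using contr[of k1] r1[of "Suc k1"] by simp
  then have c_less: "c < 1" using r1[of k1] by (simp add: zero_less_mult_iff)
  have geo: "r (k1 + n) \<le> (1 - c) ^ n * r k1" for n
  proof (induction n)
    case (Suc n)
    have "r (k1 + Suc n) \<le> (1 - c) * r (k1 + n)" using contr[of "k1 + n"] by simp
    also have "\<dots> \<le> (1 - c) * ((1 - c) ^ n * r k1)"
      using Suc c_less by (intro mult_left_mono) auto
    finally show ?case by simp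
  qed simp
  define Q where "Q = (1 - c) powr \<theta>"
  have Q: "0 < Q" "Q < 1"
    using c_pos c_less \<theta> powr_less_mono2[of \<theta> "1 - c" 1] by (simp_all add: Q_def)
  define A where "A = b / a * (C / \<theta> * r k1 powr \<theta>)"
  have A: "A \<ge> 0" using a_pos b_pos C_pos \<theta> by (simp add: A_def)
  have tail: "dist (x (k1 + n)) xbar \<le> A * Q ^ n" for n
  proof -
    have "r (k1 + n) powr \<theta> \<le> ((1 - c) ^ n * r k1) powr \<theta>"
      using geo r1[of "k1 + n"] \<theta> by (intro powr_mono2) auto
    also have "\<dots> = Q ^ n * r k1 powr \<theta>"
      using c_less r1[of k1] unfolding Q_def
      by (simp add: powr_mult powr_powr mult.commute flip: powr_realpow)
    finally have "b / a * (C / \<theta> * r (k1 + n) powr \<theta>) \<le> b / a * (C / \<theta> * (Q ^ n * r k1 powr \<theta>))"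
      using a_pos b_pos C_pos \<theta> by (intro mult_left_mono) auto
    then show ?thesis using dist[of "k1 + n"] k1(1) by (simp add: A_def mult_ac)
  qed
  \<comment> \<open>The sum covers the finitely many indices before \<open>k1\<close>, and the last
    summand shifts the tail bound back to index 0.\<close>
  define B where "B = (\<Sum>k<k1. dist (x k) xbar / Q ^ k) + A / Q ^ k1"
  have sum_nonneg: "0 \<le> (\<Sum>k<k1. dist (x k) xbar / Q ^ k)" using Q by (intro sum_nonneg) auto
  have B: "dist (x k) xbar \<le> B * Q ^ k" for k
  proof (cases "k < k1")
    case True
    then have "dist (x k) xbar / Q ^ k \<le> (\<Sum>k<k1. dist (x k) xbar / Q ^ k)"
      using Q by (intro member_le_sum) auto
    also have "\<dots> \<le> B" using A Q by (simp add: B_def)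
    finally show ?thesis using Q by (simp add: divide_le_eq)
  next
    case False
    then have "dist (x k) xbar \<le> A * Q ^ (k - k1)" using tail[of "k - k1"] by simp
    also have "\<dots> = A / Q ^ k1 * Q ^ k" using Q False by (simp add: power_diff)
    also have "\<dots> \<le> B * Q ^ k" using sum_nonneg Q by (intro mult_right_mono) (auto simp: B_def)
    finally show ?thesis .
  qed
  have "B \<ge> 0" using sum_nonneg A Q by (simp add: B_def)
  \<comment> \<open>Adding 1 makes the bound strict, even where the distance vanishes.\<close>
  moreover have "dist (x k) xbar < (B + 1) * Q ^ k" for k
    using B[of k] zero_less_power[OF Q(1), of k] by (simp add: distrib_right)
  ultimately show ?thesis using Q by (intro exI[of _ "B + 1"] exI[of _ Q] conjI) auto
qed

end

text \<open>A convergent sequence is bounded, and \<open>real k powr p\<close> is at least 1 for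
  \<open>k \<ge> 1\<close> and \<open>p \<ge> 0\<close>.\<close>

lemma polynomially_bounded_if_convergent:
  fixes x :: "nat \<Rightarrow> 'a::real_normed_vector"
  assumes "x \<longlonglongrightarrow> l" "0 \<le> p"
  shows "\<exists>B>0. \<forall>k\<ge>1. norm (x k - l) < B * real k powr p"
proof -
  have "convergent (\<lambda>k. x k - l)"
    using tendsto_diff[OF assms(1) tendsto_const[of l]] by (rule convergentI)
  then obtain B where B: "B > 0" "\<And>k. norm (x k - l) \<le> B"
    by (meson BseqE convergent_imp_Bseq)
  have "norm (x k - l) < (B + 1) * real k powr p" if "k \<ge> 1" for k
  proof -
    have "norm (x k - l) < (B + 1) * 1" using B(2)[of k] by simp
    also have "\<dots> \<le> (B + 1) * real k powr p"
      using that assms(2) B(1) by (intro mult_left_mono ge_one_powr_ge_zero) auto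
    finally show ?thesis .
  qed
  then show ?thesis using B(1) by (intro exI[of _ "B + 1"]) auto
qed

section \<open>The iteration on the manifold\<close>

theorem theorem3p14:
  fixes M :: "(real ^ 'n) set" and d :: nat
    and g :: "real ^ 'n \<Rightarrow> real ^ 'n \<Rightarrow> real ^ 'n \<Rightarrow> real"
    and R :: "real ^ 'n \<Rightarrow> real ^ 'n \<Rightarrow> real ^ 'n"
    and T :: "real ^ 'n \<Rightarrow> real ^ 'n \<Rightarrow> real ^ 'n \<Rightarrow> real ^ 'n"
    and f :: "real ^ 'n \<Rightarrow> real"
    and \<kappa> L \<nu> \<delta>0 tbar :: real
    and t :: "nat \<Rightarrow> real" and x gk :: "nat \<Rightarrow> real ^ 'n"
  assumes manifold: "embedded_submanifold M d"
    and metric: "riemannian_metric M g"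
    and retr: "manifold_retraction M R"
    and kappa: "\<kappa> > 0"
    and retr_bound: "\<forall>y\<in>M. \<forall>\<eta>\<in>tangent_space M y. norm (R y \<eta> - y) \<le> \<kappa> * riem_norm g y \<eta>"
    and transport: "vector_transport M R T"
    and isometric: "isometric_transport M g R T"
    and f_C1: "Ck_extendable_on 1 M f"
    and L_pos: "L > 0"
    and descent: "descent_condition M g R f L"
    and lipschitz: "lipschitz_gradient M g R T f L"
    and nu: "0 \<le> \<nu>" "\<nu> < 1"
    and t_nonneg: "\<forall>k\<ge>1. 0 \<le> t k"
    and t_sum: "filterlim (\<lambda>N. \<Sum>k=1..N. t k) at_top sequentially"
    and delta0: "\<delta>0 > 0"
    and t_range: "\<forall>\<^sub>F k in sequentially. t k \<in> {0 .. (2 - 2 * \<nu> - \<delta>0) / (L * (1 + \<nu>)\<^sup>2)}"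
    and x_in: "\<forall>k\<ge>1. x k \<in> M"
    and gk_in: "\<forall>k\<ge>1. gk k \<in> tangent_space M (x k)"
    and gk_err: "\<forall>k\<ge>1. riem_norm g (x k) (gk k - riem_grad M g f (x k))
                          \<le> \<nu> * riem_norm g (x k) (riem_grad M g f (x k))"
    and x_step: "\<forall>k\<ge>1. x (k + 1) = R (x k) (- t k *\<^sub>R gk k)"
    and f_bdd: "bdd_below ((\<lambda>k. f (x k)) ` {1..})"
    and tbar: "tbar > 0"
    and t_away: "\<forall>\<^sub>F k in sequentially. t k > tbar"
  shows "(\<forall>xbar \<in> accumulation_points_in M x. KL_property M g f xbar \<longrightarrow> x \<longlonglongrightarrow> xbar)
    \<and> (\<forall>xbar \<in> accumulation_points_in M x. \<forall>C \<theta> :: real.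
        C > 0 \<and> 0 < \<theta> \<and> \<theta> \<le> 1 \<and>
        KL_property_with M g f xbar (\<lambda>s. C / \<theta> * s powr \<theta>) \<longrightarrow>
          (\<exists>k0\<ge>1. stationary_point M g f (x k0) \<and> (\<forall>k\<ge>k0. x k = x k0))
          \<or> ((\<theta> = 1 \<longrightarrow> (\<exists>k1. \<forall>k>k1. x k = xbar))
            \<and> (1 / 2 \<le> \<theta> \<and> \<theta> < 1 \<longrightarrow>
                 (\<exists>Cr>0. \<exists>Q. 0 \<le> Q \<and> Q < 1 \<and> (\<forall>k\<ge>1. norm (x k - xbar) < Cr * Q ^ k)))
            \<and> (0 < \<theta> \<and> \<theta> < 1 / 2 \<longrightarrow>
                 (\<exists>Cr>0. \<forall>k\<ge>1. norm (x k - xbar)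
                     < Cr * real k powr (- ((1 - \<theta>) / (2 * \<theta> - 1)))))))"
proof -
  define G where "G k = riem_norm g (x k) (riem_grad M g f (x k))" for k
  \<comment> \<open>Step length per unit of \<open>t k * G k\<close>: \<open>\<kappa>\<close> comes
    from the retraction bound, and \<open>1 + \<nu>\<close> compares the inexact gradient with the
    exact one.\<close>
  define b where "b = \<kappa> * (1 + \<nu>)"
  have b_pos: "b > 0" using kappa nu by (simp add: b_def)
  have "\<forall>\<^sub>F k in sequentially. t k \<in> {0 .. (2 - 2 * \<nu> - \<delta>0) / (L * (1 + \<nu>)\<^sup>2)} \<and>
      t k > tbar \<and> k \<ge> 1"
    by (intro eventually_conj t_range t_away eventually_ge_at_top)
  then obtain K where K: "\<And>k. k \<ge> K \<Longrightarrow>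
      t k \<in> {0 .. (2 - 2 * \<nu> - \<delta>0) / (L * (1 + \<nu>)\<^sup>2)} \<and> t k > tbar \<and> k \<ge> 1"
    unfolding eventually_sequentially by blast
  have xM: "x k \<in> M" and t_pos: "t k > 0" if "k \<ge> K" for k
    using K[OF that] x_in tbar by auto
  have inner: "inner_on (tangent_space M (x k)) (g (x k))" if "k \<ge> K" for k
    by (rule riemannian_metric_inner_on[OF manifold metric xM[OF that]])
  have grad_in: "riem_grad M g f (x k) \<in> tangent_space M (x k)" if "k \<ge> K" for k
    by (rule riem_grad_in_tangent_space[OF manifold metric f_C1 xM[OF that]])
  have G_nonneg: "G k \<ge> 0" if "k \<ge> K" for k
    using inner_on.nonneg[OF inner grad_in] that by (simp add: G_def riem_norm_def)
  have desc_f: "\<delta>0 / 2 * (t k * G k) * G k \<le> f (x k) - f (x (Suc k))"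
    and step_le: "dist (x (Suc k)) (x k) \<le> b * (t k * G k)" if k: "k \<ge> K" for k
  proof -
    interpret inner_on "tangent_space M (x k)" "g (x k)" by (rule inner[OF k])
    let ?\<eta> = "- t k *\<^sub>R gk k"
    have gk: "gk k \<in> tangent_space M (x k)" using gk_in K[OF k] by simp
    then have \<eta>: "?\<eta> \<in> tangent_space M (x k)" using sub by (rule_tac subspace_scale)
    have next_x: "x (Suc k) = R (x k) ?\<eta>" using x_step K[OF k] by simp
    have err: "sqrt (g (x k) (gk k - riem_grad M g f (x k)) (gk k - riem_grad M g f (x k)))
        \<le> \<nu> * sqrt (g (x k) (riem_grad M g f (x k)) (riem_grad M g f (x k)))"
      using gk_err K[OF k] by (simp add: riem_norm_def)
    have "0 \<le> t k" "t k \<le> (2 - 2 * \<nu> - \<delta>0) / (L * (1 + \<nu>)\<^sup>2)" using K[OF k] by auto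
    note est = inexact_gradient_descent[OF inner[OF k] grad_in[OF k] gk err this L_pos nu(1)]
    have "f (x (Suc k)) \<le> f (x k) + g (x k) (riem_grad M g f (x k)) ?\<eta>
        + L / 2 * (riem_norm g (x k) ?\<eta>)\<^sup>2"
      unfolding next_x using descent xM[OF k] \<eta> by (auto simp: descent_condition_def)
    moreover have "(G k)\<^sup>2 = g (x k) (riem_grad M g f (x k)) (riem_grad M g f (x k))"
      using nonneg[OF grad_in[OF k]] by (simp add: G_def riem_norm_def)
    ultimately show "\<delta>0 / 2 * (t k * G k) * G k \<le> f (x k) - f (x (Suc k))"
      using est(2) by (simp add: riem_norm_def power2_eq_square mult.assoc)
    have "dist (x (Suc k)) (x k) \<le> \<kappa> * riem_norm g (x k) ?\<eta>"
      unfolding next_x dist_norm using retr_bound xM[OF k] \<eta> by blast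
    also have "riem_norm g (x k) ?\<eta> = t k * sqrt (g (x k) (gk k) (gk k))"
      unfolding riem_norm_def norm_scale[OF gk] using t_pos[OF k] by simp
    also have "\<kappa> * (t k * sqrt (g (x k) (gk k) (gk k))) \<le> \<kappa> * (t k * ((1 + \<nu>) * G k))"
      using est(1) kappa t_pos[OF k]
      by (intro mult_left_mono) (auto simp: G_def riem_norm_def)
    finally show "dist (x (Suc k)) (x k) \<le> b * (t k * G k)" by (simp add: b_def mult_ac)
  qed
  have f_Suc: "f (x (Suc k)) \<le> f (x k)" if "k \<ge> K" for k
  proof -
    have "0 \<le> \<delta>0 / 2 * (t k * G k) * G k"
      using delta0 t_pos[OF that] G_nonneg[OF that] by simp
    then show ?thesis using desc_f[OF that] by linarith
  qed
  then have dec: "decseq (\<lambda>n. f (x (n + K)))" by (intro decseq_SucI) simp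
  obtain m where m: "\<And>k. k \<ge> 1 \<Longrightarrow> m \<le> f (x k)"
    using f_bdd unfolding bdd_below_def by auto
  have "\<forall>n. m \<le> f (x (n + K))" using m K by simp
  then obtain l where "(\<lambda>n. f (x (n + K))) \<longlonglongrightarrow> l"
    using decseq_convergent[OF dec, of m] by blast
  then have f_l: "(\<lambda>k. f (x k)) \<longlonglongrightarrow> l" by (rule LIMSEQ_offset)
  \<comment> \<open>Monotonicity makes all function values converge to one limit; continuity of
    \<open>f\<close> along the subsequence that tends to \<open>xbar\<close> identifies it.\<close>
  have f_lim: "(\<lambda>k. f (x k)) \<longlonglongrightarrow> f xbar" if xbar: "xbar \<in> accumulation_points_in M x" for xbar
  proof -
    obtain \<sigma> where \<sigma>: "strict_mono \<sigma>" "(x \<circ> \<sigma>) \<longlonglongrightarrow> xbar" "xbar \<in> M"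
      using xbar by (auto simp: accumulation_points_in_def)
    have "x (\<sigma> n) \<in> M" if "n \<ge> K" for n
      using xM[of "\<sigma> n"] seq_suble[OF \<sigma>(1), of n] that by simp
    then have "\<forall>\<^sub>F n in sequentially. (x \<circ> \<sigma>) n \<in> M"
      by (auto simp: eventually_sequentially)
    then have "(\<lambda>n. f ((x \<circ> \<sigma>) n)) \<longlonglongrightarrow> f xbar"
      by (rule Ck_extendable_tendsto[OF f_C1 \<sigma>(3,2)])
    moreover have "(\<lambda>n. f ((x \<circ> \<sigma>) n)) \<longlonglongrightarrow> l"
      using LIMSEQ_subseq_LIMSEQ[OF f_l \<sigma>(1)] by (simp add: o_def)
    ultimately show ?thesis using f_l LIMSEQ_unique by blast
  qed
  have f_ge: "f xbar \<le> f (x k)" if "xbar \<in> accumulation_points_in M x" "k \<ge> K" for xbar k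
    using decseq_ge[OF dec LIMSEQ_ignore_initial_segment[OF f_lim[OF that(1)]], of "k - K"] that(2)
    by simp
  \<comment> \<open>Once the limiting value is attained, no decrease remains. With positive
    stepsizes the gradients vanish from then on, and the step bound freezes the iterates.\<close>
  have stops: "stationary_point M g f (x k)" "\<And>j. j \<ge> k \<Longrightarrow> x j = x k"
    if xbar: "xbar \<in> accumulation_points_in M x" and k: "k \<ge> K" and eq: "f (x k) = f xbar"
    for xbar k
  proof -
    have G0: "G j = 0" if "j \<ge> k" for j
    proof -
      have "f (x j) \<le> f (x k)"
        using decseqD[OF dec, of "k - K" "j - K"] that k by simp
      then have "f (x j) - f (x (Suc j)) \<le> 0" using f_ge[OF xbar, of "Suc j"] that k eq by simp
      then have "\<delta>0 / 2 * (t j * G j) * G j \<le> 0" using desc_f[of j] that k by simp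
      moreover have "0 < \<delta>0 / 2 * (t j * G j) * G j" if "G j > 0"
        using that delta0 t_pos[of j] \<open>j \<ge> k\<close> k by simp
      ultimately have "\<not> G j > 0" by linarith
      then show ?thesis using G_nonneg[of j] that k by simp
    qed
    show "stationary_point M g f (x k)"
      using G0[of k] inner_on.pos[OF inner[OF k] grad_in[OF k]] xM[OF k]
      by (auto simp: stationary_point_def G_def riem_norm_def)
    show "x j = x k" if "j \<ge> k" for j
      using that
    proof (induction rule: dec_induct)
      case (step j)
      then show ?case using step_le[of j] G0[of j] k by simp
    qed simp
  qed
  \<comment> \<open>If the limiting value is never attained from \<open>K\<close> on, all these gaps
    are positive, as the abstract setting demands.\<close>
  have KL_descent: "\<exists>\<epsilon> \<delta>. KL_descent x xbar (\<lambda>k. f (x k) - f xbar) (\<lambda>k. t k * G k) G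
      (\<delta>0 / 2) b \<epsilon> K \<phi> \<delta>"
    if xbar: "xbar \<in> accumulation_points_in M x" and KL: "KL_property_with M g f xbar \<phi>"
      and ne: "\<And>k. k \<ge> K \<Longrightarrow> f (x k) \<noteq> f xbar" for xbar \<phi>
  proof -
    obtain \<delta> U W where \<delta>: "0 < \<delta>" and W: "openin (top_of_set M) W" "xbar \<in> W" "W \<subseteq> U"
      and desing: "desingularizing \<delta> \<phi>"
      and ineq: "\<And>y. y \<in> U \<Longrightarrow> f xbar < f y \<Longrightarrow> ereal (f y) < ereal (f xbar) + \<delta> \<Longrightarrow>
        deriv \<phi> (f y - f xbar) * riem_norm g y (riem_grad M g f y) \<ge> 1"
      using KL unfolding KL_property_with_def by blast
    \<comment> \<open>Relative openness of \<open>W\<close> turns the KL neighborhood into a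
      Euclidean ball, of which only the points in \<open>M\<close> count.\<close>
    obtain \<epsilon> where \<epsilon>: "\<epsilon> > 0" "ball xbar \<epsilon> \<inter> M \<subseteq> W"
      using W(1)[unfolded openin_contains_ball] W(2) by blast
    have gap: "f (x k) - f xbar > 0" if "k \<ge> K" for k
      using f_ge[OF xbar that] ne[OF that] by simp
    have "KL_descent x xbar (\<lambda>k. f (x k) - f xbar) (\<lambda>k. t k * G k) G (\<delta>0 / 2) b \<epsilon> K \<phi> \<delta>"
    proof
      show "(\<lambda>k. f (x k) - f xbar) \<longlonglongrightarrow> 0"
        using f_lim[OF xbar] by (simp add: LIM_zero)
      show "\<exists>\<sigma>. strict_mono \<sigma> \<and> (x \<circ> \<sigma>) \<longlonglongrightarrow> xbar"
        using xbar by (simp add: accumulation_points_in_def)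
      show "1 \<le> deriv \<phi> (f (x k) - f xbar) * G k"
        if "k \<ge> K" "dist (x k) xbar < \<epsilon>" "ereal (f (x k) - f xbar) < \<delta>" for k
        unfolding G_def
      proof (rule ineq)
        have "x k \<in> ball xbar \<epsilon> \<inter> M" using that(2) xM[OF that(1)] by (simp add: dist_commute)
        then show "x k \<in> U" using \<epsilon>(2) W(3) by blast
        show "f xbar < f (x k)" using gap[OF that(1)] by simp
        show "ereal (f (x k)) < ereal (f xbar) + \<delta>" using that(3) by (cases \<delta>) auto
      qed
      show "0 \<le> t k * G k" if "k \<ge> K" for k using t_pos[OF that] G_nonneg[OF that] by simp
      show "\<delta>0 / 2 * (t k * G k) * G k \<le> f (x k) - f xbar - (f (x (Suc k)) - f xbar)"
        if "k \<ge> K" for k using desc_f[OF that] by simp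
    qed (use desing \<delta> delta0 b_pos \<epsilon>(1) in \<open>simp_all add: gap G_nonneg step_le del: diff_gt_0_iff_gt\<close>)
    then show ?thesis by blast
  qed
  have converges: "x \<longlonglongrightarrow> xbar"
    if xbar: "xbar \<in> accumulation_points_in M x" and KL: "KL_property M g f xbar" for xbar
  proof (cases "\<exists>k\<ge>K. f (x k) = f xbar")
    case True
    then obtain k where k: "k \<ge> K" "f (x k) = f xbar" by blast
    have "\<forall>\<^sub>F j in sequentially. x j = x k"
      unfolding eventually_sequentially using stops(2)[OF xbar k] by blast
    then have "x \<longlonglongrightarrow> x k" by (rule tendsto_eventually)
    \<comment> \<open>The eventually constant value must be \<open>xbar\<close>, being the limit of
      a subsequence as well.\<close>
    moreover obtain \<sigma> where "strict_mono \<sigma>" "(x \<circ> \<sigma>) \<longlonglongrightarrow> xbar"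
      using xbar by (auto simp: accumulation_points_in_def)
    ultimately show ?thesis using LIMSEQ_subseq_LIMSEQ LIMSEQ_unique by blast
  next
    case False
    obtain \<phi> where \<phi>: "KL_property_with M g f xbar \<phi>" using KL by (auto simp: KL_property_def)
    have "f (x k) \<noteq> f xbar" if "k \<ge> K" for k using False that by blast
    from KL_descent[OF xbar \<phi> this] show ?thesis using KL_descent.converges by blast
  qed
  have rates: "(\<exists>k0\<ge>1. stationary_point M g f (x k0) \<and> (\<forall>k\<ge>k0. x k = x k0))
      \<or> ((\<theta> = 1 \<longrightarrow> (\<exists>k1. \<forall>k>k1. x k = xbar))
        \<and> (1 / 2 \<le> \<theta> \<and> \<theta> < 1 \<longrightarrow>
             (\<exists>Cr>0. \<exists>Q. 0 \<le> Q \<and> Q < 1 \<and> (\<forall>k\<ge>1. norm (x k - xbar) < Cr * Q ^ k)))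
        \<and> (0 < \<theta> \<and> \<theta> < 1 / 2 \<longrightarrow>
             (\<exists>Cr>0. \<forall>k\<ge>1. norm (x k - xbar)
                 < Cr * real k powr (- ((1 - \<theta>) / (2 * \<theta> - 1))))))"
    (is "?stops \<or> ?rates")
    if xbar: "xbar \<in> accumulation_points_in M x" and C: "C > 0" and \<theta>: "0 < \<theta>" "\<theta> \<le> 1"
      and KL: "KL_property_with M g f xbar (\<lambda>s. C / \<theta> * s powr \<theta>)" for xbar C \<theta>
  proof (cases "\<exists>k\<ge>K. f (x k) = f xbar")
    case True
    then obtain k where k: "k \<ge> K" "f (x k) = f xbar" by blast
    then have ?stops using stops[OF xbar k] K[OF k(1)] by blast
    then show ?thesis ..
  next
    case False
    then have ne: "f (x k) \<noteq> f xbar" if "k \<ge> K" for k using that by blast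
    obtain \<epsilon> \<delta> where "KL_descent x xbar (\<lambda>k. f (x k) - f xbar) (\<lambda>k. t k * G k) G (\<delta>0 / 2) b \<epsilon> K
        (\<lambda>s. C / \<theta> * s powr \<theta>) \<delta>"
      using KL_descent[OF xbar KL ne] by blast
    then interpret KL_descent x xbar "\<lambda>k. f (x k) - f xbar" "\<lambda>k. t k * G k" G "\<delta>0 / 2" b \<epsilon> K
      "\<lambda>s. C / \<theta> * s powr \<theta>" \<delta> .
    interpret KL_descent_powr x xbar "\<lambda>k. f (x k) - f xbar" "\<lambda>k. t k * G k" G "\<delta>0 / 2" b \<epsilon> K \<delta>
      C \<theta> tbar
    proof
      show "tbar * G k \<le> t k * G k" if "k \<ge> K" for k
        using K[OF that] G_nonneg[OF that] by (intro mult_right_mono) auto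
    qed (use C \<theta> tbar in auto)
    have "x \<longlonglongrightarrow> xbar" by (rule KL_descent.converges) unfold_locales
    text \<open>For \<open>\<theta> < 1 / 2\<close> the exponent \<open>- (1 - \<theta>) / (2 * \<theta> - 1)\<close> is positive, so convergence alone
      gives the bound.\<close>
    then have "\<exists>Cr>0. \<forall>k\<ge>1. norm (x k - xbar)
        < Cr * real k powr (- ((1 - \<theta>) / (2 * \<theta> - 1)))" if "\<theta> < 1 / 2"
      using that by (intro polynomially_bounded_if_convergent)
        (simp_all add: divide_nonneg_neg divide_nonpos_neg flip: minus_divide_right)
    moreover have "\<exists>Cr>0. \<exists>Q. 0 \<le> Q \<and> Q < 1 \<and> (\<forall>k\<ge>1. norm (x k - xbar) < Cr * Q ^ k)"
      if "1 / 2 \<le> \<theta>"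
      using linear_rate[OF that] unfolding dist_norm by blast
    \<comment> \<open>The clause for \<open>\<theta> = 1\<close> holds vacuously: gaps that stay
      positive exclude this exponent.\<close>
    ultimately have ?rates using exponent_ne_1 by blast
    then show ?thesis ..
  qed
  show ?thesis using converges rates by blast
qed

end
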